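(* Let $M$ be an $\infty$-definable submonoid of $M_2(\mathbb{C})$ (this includes the case that $M$ is definable), and write $M=H\cup S$ with $H=M\cap GL_2(\mathbb{C})$ and $S=M\cap M_2^0(\mathbb{C})$. Suppose $\pi(S)=B_{F,G}$ for some $F,G\subseteq\mathbb{C}P^1$. Then $M$ is an intersection of definable submonoids of $M_2(\mathbb{C})$.
   Context: Work in the field $\mathbb{C}$ as a first-order structure in the language of rings $\{+,-,\cdot,0,1\}$. A subset of $\mathbb{C}^k$ is definable if it is defined by a first-order formula with parameters from $\mathbb{C}$ (equivalently, by quantifier elimination, a constructible set), and $\infty$-definable if it is an intersection of (possibly infinitely many) definable sets. Matrices are identified with points of $\mathbb{C}^4$. $M_2^0(\mathbb{C})$ is the set of singular $2\times2$ complex matrices. $PM_2(\mathbb{C})=M_2(\mathbb{C})/\mathbb{C}^\times$ is the quotient monoid by nonzero scalars, with quotient homomorphism $\pi:M_2(\mathbb{C})\to PM_2(\mathbb{C})$; $PM_2^0(\mathbb{C})=\pi(M_2^0(\mathbb{C}))$ and $PGL_2(\mathbb{C})=\pi(GL_2(\mathbb{C}))$. Each nonzero element of $PM_2^0(\mathbb{C})$ is $\pi(A)$ for a rank-one matrix $A$ and is identified with the pair $(v,u)\in(\mathbb{C}P^1)^2$ where $v$ is the image (column space) of $A$ and $u$ is its kernel; the zero element is $0=\pi(0)$. For $F,G\subseteq \mathbb{C}P^1$, $B_{F,G}=\{(v,u): v\in F,\ u\in G\}\cup\{0\}\subseteq PM_2^0(\mathbb{C})$. A definable submonoid means a submonoid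 of $M_2(\mathbb{C})$ whose underlying set is definable.
   Formalization: "∞-definable" is taken as an intersection of fewer than continuum many definable sets (and the conclusion gives fewer than continuum many definable submonoids); for unrestricted families every set is ∞-definable and the claim fails, e.g. M = {2^n I : n ≥ 0} ∪ {0}. *)

theory Defs
  imports "HOL-Analysis.Analysis" "HOL-Library.Equipollence" "HOL-Algebra.Group"
begin

section \<open>Definable sets in the field of complex numbers\<close>

datatype ring_term =
    RVar nat
  | RZero
  | ROne
  | RAdd ring_term ring_term
  | RSub ring_term ring_term
  | RMul ring_term ring_term

datatype ring_formula =
    REq ring_term ring_term
  | RNot ring_formula
  | RAnd ring_formula ring_formula
  | REx nat ring_formula

primrec term_val :: "(nat \<Rightarrow> complex) \<Rightarrow> ring_term \<Rightarrow> complex" where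
  "term_val e (RVar n) = e n"
| "term_val e RZero = 0"
| "term_val e ROne = 1"
| "term_val e (RAdd s t) = term_val e s + term_val e t"
| "term_val e (RSub s t) = term_val e s - term_val e t"
| "term_val e (RMul s t) = term_val e s * term_val e t"

primrec sat :: "(nat \<Rightarrow> complex) \<Rightarrow> ring_formula \<Rightarrow> bool" where
  "sat e (REq s t) \<longleftrightarrow> term_val e s = term_val e t"
| "sat e (RNot p) \<longleftrightarrow> \<not> sat e p"
| "sat e (RAnd p q) \<longleftrightarrow> sat e p \<and> sat e q"
| "sat e (REx n p) \<longleftrightarrow> (\<exists>z. sat (e(n := z)) p)"

text \<open>
  Points of complex affine k-space are lists of length \<open>k\<close>. The free variables \<open>0, ..., k - 1\<close>
  of the formula are the coordinates; every other free variable is interpreted by the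
  assignment \<open>e\<close>, which thereby supplies the (finitely many) parameters.
\<close>

definition definable :: "nat \<Rightarrow> complex list set \<Rightarrow> bool" where
  "definable k X \<longleftrightarrow>
     (\<exists>p e. X = {x. length x = k \<and> sat (\<lambda>n. if n < k then x ! n else e n) p})"

type_synonym mat2 = "complex^2^2"

definition mat_coords :: "mat2 \<Rightarrow> complex list" where
  "mat_coords A = [A $ 1 $ 1, A $ 1 $ 2, A $ 2 $ 1, A $ 2 $ 2]"

definition definable_mat :: "mat2 set \<Rightarrow> bool" where
  "definable_mat X \<longleftrightarrow> definable 4 (mat_coords ` X)"

text \<open>
  Intersections are small in the usual model-theoretic sense: the complex field is a saturated
  model of cardinality continuum, and families of definable sets are required to have fewer than
  continuum many members. Without this bound the notion would be void, since every set \<open>X\<close> is the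
  intersection of the definable sets \<open>- {a}\<close> with \<open>a \<notin> X\<close>.
\<close>

definition small_Inter_of :: "(mat2 set \<Rightarrow> bool) \<Rightarrow> mat2 set \<Rightarrow> bool" where
  "small_Inter_of P X \<longleftrightarrow>
     (\<exists>\<D>. \<D> \<prec> (UNIV :: complex set) \<and> (\<forall>D\<in>\<D>. P D) \<and> X = \<Inter>\<D>)"

definition inf_definable :: "mat2 set \<Rightarrow> bool" where
  "inf_definable = small_Inter_of definable_mat"


section \<open>The monoid of 2 by 2 matrices and its quotient by scalars\<close>

definition M2 :: "mat2 monoid" where
  "M2 = \<lparr>carrier = UNIV, monoid.mult = (**), one = mat 1\<rparr>"

definition GL2 :: "mat2 set" where
  "GL2 = {A. invertible A}"

definition M20 :: "mat2 set" where
  "M20 = {A. det A = 0}"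

definition definable_submonoid :: "mat2 set \<Rightarrow> bool" where
  "definable_submonoid N \<longleftrightarrow> submonoid N M2 \<and> definable_mat N"

definition scalar_rel :: "(mat2 \<times> mat2) set" where
  "scalar_rel = {(A, B). \<exists>c. c \<noteq> 0 \<and> B = (\<chi> i j. c * A $ i $ j)}"

text \<open>The quotient map \<open>\<pi>\<close>; its values are the scalar classes, the elements of \<open>UNIV // scalar_rel\<close>.\<close>

definition PM2_proj :: "mat2 \<Rightarrow> mat2 set" where
  "PM2_proj A = scalar_rel `` {A}"

definition CP1 :: "(complex^2) set set" where
  "CP1 = {L. vec.subspace L \<and> vec.dim L = 1}"

definition mat_image :: "mat2 \<Rightarrow> (complex^2) set" where
  "mat_image A = range (\<lambda>x. A *v x)"

definition mat_kernel :: "mat2 \<Rightarrow> (complex^2) set" where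
  "mat_kernel A = {x. A *v x = 0}"

text \<open>
  The class of a rank-one matrix is determined by, and identified with, its pair (image, kernel);
  every pair of points of the projective line arises in this way.
\<close>

definition B_set :: "(complex^2) set set \<Rightarrow> (complex^2) set set \<Rightarrow> mat2 set set" where
  "B_set F G = {PM2_proj A |A. rank A = 1 \<and> mat_image A \<in> F \<and> mat_kernel A \<in> G} \<union> {PM2_proj 0}"

end

(*
  By quantifier elimination definable sets are constructible, so a definable subset of the complex
  line is finite or cofinite. Fewer than continuum many finite sets do not cover the line, which
  gives saturation for one variable and, by projecting, for several.

  The group part H of M is then shown to be Zariski closed in GL2. Its closure Y is a closed
  cancellative monoid, hence a group by the Noetherian property. Every definable D containing H
  contains a dense open subset of Y, so each h in Y lies in D ** D, and by saturation h is a product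
  of two elements of H. The same argument shows that the scalars c with c e in M form a definable
  group E for a rank one idempotent e.

  If every singular element of M has trace 0, these elements are multiples of one nilpotent n, and
  between M and a definable D lies the definable monoid formed by H and the multiples A of n with
  H ** A ** H contained in D. Otherwise M contains a rank one idempotent e, and the hypothesis on
  the image of S yields M = H \<union> P ** Q with P = {A \<in> M. A ** e = A} and Q = {B \<in> M. e ** B = B}, where
  Q ** P is contained in E ** e together with 0. By compactness these relations still hold with M
  replaced by some definable D' containing M, and cutting P and Q down to their parts stable under
  H and E gives a definable monoid.
*)
theory Submission
  imports Defs "HOL-Computational_Algebra.Fundamental_Theorem_Algebra"
begin

section \<open>Quantifier elimination\<close>

text \<open>The obstacle is that \<open>M\<close> is only an infinite intersection, so a condition
  such as M ** A ** M being contained in \<open>D\<close> quantifies over \<open>M\<close> and is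
  not first-order. Quantifying over \<open>H\<close> and over the scalar group \<open>E\<close> is
  allowed once these are known to be definable, which is why the definability of groups precedes the
  construction of monoids. For products of two singular elements no such quantifier is available,
  and the factorisation through \<open>P\<close> and \<open>Q\<close> replaces it: in (A ** B) **
  (A' ** B') the middle product B ** A' is 0 or k ** e with k in \<open>E\<close>; in the second
  case A absorbs k and B' absorbs e, so the result again lies in P ** Q. The hypothesis on the image
  of S combines images and kernels only up to an uncontrolled scalar; where a correction is
  necessary, it is found inside \<open>E\<close> by comparing several products in
  \<open>M\<close>.\<close>

inductive_set fun_alg :: "('a \<Rightarrow> complex) set \<Rightarrow> ('a \<Rightarrow> complex) set"
  for G :: "('a \<Rightarrow> complex) set" where
  const: "(\<lambda>_. c) \<in> fun_alg G"
| gen: "g \<in> G \<Longrightarrow> g \<in> fun_alg G"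
| add: "f \<in> fun_alg G \<Longrightarrow> g \<in> fun_alg G \<Longrightarrow> (\<lambda>x. f x + g x) \<in> fun_alg G"
| mult: "f \<in> fun_alg G \<Longrightarrow> g \<in> fun_alg G \<Longrightarrow> (\<lambda>x. f x * g x) \<in> fun_alg G"

lemma fun_alg_uminus: "f \<in> fun_alg G \<Longrightarrow> (\<lambda>x. - f x) \<in> fun_alg G"
  using fun_alg.mult[OF fun_alg.const[of "-1"]] by simp

lemma fun_alg_diff: "f \<in> fun_alg G \<Longrightarrow> g \<in> fun_alg G \<Longrightarrow> (\<lambda>x. f x - g x) \<in> fun_alg G"
  using fun_alg.add[of f G "\<lambda>x. - g x"] fun_alg_uminus[of g G] by simp

lemma fun_alg_sum:
  "(\<And>i. i \<in> I \<Longrightarrow> f i \<in> fun_alg G) \<Longrightarrow> (\<lambda>x. \<Sum>i\<in>I. f i x) \<in> fun_alg G"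
  by (induction I rule: infinite_finite_induct) (auto intro: fun_alg.intros)

lemma fun_alg_compose:
  assumes "f \<in> fun_alg G" "\<And>g. g \<in> G \<Longrightarrow> (\<lambda>x. g (s x)) \<in> fun_alg G'"
  shows "(\<lambda>x. f (s x)) \<in> fun_alg G'"
  using assms(1) by induction (auto intro: fun_alg.intros assms(2))

text \<open>Polynomials are represented by the functions they induce on assignments. Complex
  coefficients are built in, so parameters need no bookkeeping until predicates are translated back
  into formulas.\<close>

abbreviation poly_funs :: "((nat \<Rightarrow> complex) \<Rightarrow> complex) set" where
  "poly_funs \<equiv> fun_alg (range (\<lambda>n e. e n))"

lemma poly_funs_var: "(\<lambda>e. e n) \<in> poly_funs"
  by (intro fun_alg.gen) auto

lemma poly_funs_compose:
  assumes "f \<in> poly_funs" "\<And>n. (\<lambda>x. s x n) \<in> fun_alg G"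
  shows "(\<lambda>x. f (s x)) \<in> fun_alg G"
  by (rule fun_alg_compose[OF assms(1)]) (use assms(2) in auto)

text \<open>Boolean combinations of polynomial equations, taken as predicates on assignments and not
  as sets of tuples: the number of free variables is never fixed, and a quantifier acts by updating
  the assignment.\<close>

inductive constructible :: "((nat \<Rightarrow> complex) \<Rightarrow> bool) \<Rightarrow> bool" where
  eq0: "f \<in> poly_funs \<Longrightarrow> constructible (\<lambda>e. f e = 0)"
| neg: "constructible Q \<Longrightarrow> constructible (\<lambda>e. \<not> Q e)"
| conj: "constructible Q \<Longrightarrow> constructible R \<Longrightarrow> constructible (\<lambda>e. Q e \<and> R e)"

lemma constructible_disj: "constructible Q \<Longrightarrow> constructible R \<Longrightarrow> constructible (\<lambda>e. Q e \<or> R e)"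
  using constructible.neg[OF constructible.conj[OF constructible.neg constructible.neg]] by simp

lemma constructible_imp: "constructible Q \<Longrightarrow> constructible R \<Longrightarrow> constructible (\<lambda>e. Q e \<longrightarrow> R e)"
  unfolding imp_conv_disj by (intro constructible_disj constructible.neg)

lemma constructible_eq: "f \<in> poly_funs \<Longrightarrow> g \<in> poly_funs \<Longrightarrow> constructible (\<lambda>e. f e = g e)"
  using constructible.eq0[OF fun_alg_diff, of f g] by simp

lemma constructible_const: "constructible (\<lambda>_. b)"
  using constructible.eq0[OF fun_alg.const[of 0]] constructible.eq0[OF fun_alg.const[of 1]] by (cases b) simp_all

lemma constructible_Ball: "finite I \<Longrightarrow> (\<And>i. i \<in> I \<Longrightarrow> constructible (Q i)) \<Longrightarrow> constructible (\<lambda>e. \<forall>i\<in>I. Q i e)"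
  by (induction I rule: finite_induct) (auto intro: constructible_const constructible.conj)

lemma constructible_Bex: "finite I \<Longrightarrow> (\<And>i. i \<in> I \<Longrightarrow> constructible (Q i)) \<Longrightarrow> constructible (\<lambda>e. \<exists>i\<in>I. Q i e)"
  by (induction I rule: finite_induct) (auto intro: constructible_const constructible_disj)

lemma constructible_compose:
  assumes "constructible Q" "\<And>n. (\<lambda>e. s e n) \<in> poly_funs"
  shows "constructible (\<lambda>e. Q (s e))"
  using assms(1)
proof induction
  case (eq0 f)
  show ?case by (rule constructible.eq0[OF poly_funs_compose[OF eq0 assms(2)]])
qed (auto intro: constructible.intros)

text \<open>
  In a single variable \<open>z\<close>, a polynomial function of \<open>e\<close> is a family of univariate polynomials \<open>p e\<close>.
  Elimination of \<open>z\<close> works on such families, so that facts about univariate complex polynomials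
  apply pointwise.
\<close>

definition poly_family :: "nat \<Rightarrow> ((nat \<Rightarrow> complex) \<Rightarrow> complex poly) \<Rightarrow> bool" where
  "poly_family b p \<longleftrightarrow> (\<forall>i. (\<lambda>e. coeff (p e) i) \<in> poly_funs) \<and> (\<forall>e. \<forall>i\<ge>b. coeff (p e) i = 0)"

lemma poly_family_coeff: "poly_family b p \<Longrightarrow> (\<lambda>e. coeff (p e) i) \<in> poly_funs"
  by (simp add: poly_family_def)

lemma poly_family_mult:
  assumes "poly_family b p" "poly_family c q" shows "poly_family (b + c) (\<lambda>e. p e * q e)"
  unfolding poly_family_def
proof (intro conjI allI impI)
  show "(\<lambda>e. coeff (p e * q e) i) \<in> poly_funs" for i
    unfolding coeff_mult
    by (intro fun_alg_sum fun_alg.mult) (use assms in \<open>auto simp: poly_family_def\<close>)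
  show "coeff (p e * q e) i = 0" if "b + c \<le> i" for e i
    unfolding coeff_mult
  proof (intro sum.neutral ballI)
    fix j assume "j \<in> {..i}"
    then have "b \<le> j \<or> c \<le> i - j" using that by auto
    then show "coeff (p e) j * coeff (q e) (i - j) = 0"
      using assms by (auto simp: poly_family_def)
  qed
qed

lemma poly_family_add: "poly_family b p \<Longrightarrow> poly_family c q \<Longrightarrow> poly_family (max b c) (\<lambda>e. p e + q e)"
  by (auto simp: poly_family_def intro: fun_alg.add)

lemma poly_family_diff: "poly_family b p \<Longrightarrow> poly_family c q \<Longrightarrow> poly_family (max b c) (\<lambda>e. p e - q e)"
  by (auto simp: poly_family_def intro: fun_alg_diff)

lemma poly_family_monom: "f \<in> poly_funs \<Longrightarrow> poly_family (Suc k) (\<lambda>e. monom (f e) k)"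
proof -
  have "f \<in> poly_funs \<Longrightarrow> (\<lambda>e. if k = i then f e else 0) \<in> poly_funs" for i
    by (cases "k = i") (auto intro: fun_alg.const)
  then show "f \<in> poly_funs \<Longrightarrow> poly_family (Suc k) (\<lambda>e. monom (f e) k)"
    by (auto simp: poly_family_def)
qed

lemma poly_family_smult: "f \<in> poly_funs \<Longrightarrow> poly_family b p \<Longrightarrow> poly_family b (\<lambda>e. smult (f e) (p e))"
  by (auto simp: poly_family_def intro: fun_alg.mult)

lemma poly_family_one: "poly_family 1 (\<lambda>e. 1)"
  by (auto simp: poly_family_def coeff_1 intro: fun_alg.const)

lemma poly_family_power: "poly_family b p \<Longrightarrow> \<exists>c. poly_family c (\<lambda>e. p e ^ k)"
  by (induction k) (auto intro: poly_family_one poly_family_mult)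

lemma poly_family_reduce: "poly_family (Suc b) p \<Longrightarrow> (\<And>e. coeff (p e) b = 0) \<Longrightarrow> poly_family b p"
  unfolding poly_family_def by (metis Suc_leI le_neq_implies_less)

lemma poly_family_truncate:
  assumes "poly_family (Suc b) p" shows "poly_family b (\<lambda>e. p e - monom (coeff (p e) b) b)"
proof (rule poly_family_reduce)
  show "poly_family (Suc b) (\<lambda>e. p e - monom (coeff (p e) b) b)"
    using poly_family_diff[OF assms poly_family_monom[OF poly_family_coeff[OF assms]], of b b] by simp
qed simp

text \<open>Multiplying \<open>q e\<close> by the formal leading coefficient of \<open>p e\<close>
  avoids a division that would leave the polynomial functions. The bounds are uniform in
  \<open>e\<close>, so a formal leading coefficient may vanish at some \<open>e\<close>.\<close>

lemma poly_family_pseudo_rem: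
  assumes "poly_family (Suc d) p" "poly_family (Suc m) q" "d \<le> m"
  shows "poly_family m (\<lambda>e. smult (coeff (p e) d) (q e) - monom (coeff (q e) m) (m - d) * p e)"
proof (rule poly_family_reduce)
  have "coeff (monom (coeff (q e) m) (m - d) * p e) i = coeff (q e) m * coeff (p e) (i - (m - d))"
    if "i \<ge> m" for e i
    using that by (simp add: coeff_monom_mult)
  then have *: "coeff (monom (coeff (q e) m) (m - d) * p e) i =
      (if i = m then coeff (q e) m * coeff (p e) d else 0)" if "i \<ge> m" for e i
    using that assms(1,3) by (auto simp: poly_family_def)
  then show "coeff (smult (coeff (p e) d) (q e) - monom (coeff (q e) m) (m - d) * p e) m = 0" for e
    by simp
  have "poly_family (Suc m) (\<lambda>e. monom (coeff (q e) m) (m - d) * p e)"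
    using poly_family_mult[OF poly_family_monom[OF poly_family_coeff[OF assms(2)]] assms(1)] *
    by (auto simp: poly_family_def)
  from poly_family_diff[OF poly_family_smult[OF poly_family_coeff[OF assms(1)] assms(2)] this]
  show "poly_family (Suc m) (\<lambda>e. smult (coeff (p e) d) (q e) - monom (coeff (q e) m) (m - d) * p e)"
    by simp
qed

lemma constructible_poly_family_zero:
  assumes "poly_family b p" shows "constructible (\<lambda>e. p e = 0)"
proof -
  have "p e = 0 \<longleftrightarrow> (\<forall>i\<in>{..<b}. coeff (p e) i = 0)" for e
    using assms unfolding poly_family_def poly_eq_iff coeff_0 by (meson lessThan_iff not_le)
  then show ?thesis
    using constructible_Ball[OF finite_lessThan constructible.eq0[OF poly_family_coeff[OF assms]], of b "\<lambda>i. i"] by presburger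
qed

lemma constructible_coeff_nz: "poly_family b p \<Longrightarrow> constructible (\<lambda>e. coeff (p e) i \<noteq> 0)"
  by (intro constructible.neg constructible.eq0 poly_family_coeff)

lemma constructible_split:
  assumes "f \<in> poly_funs" "constructible Q1" "constructible Q2"
    and "\<And>e. f e = 0 \<Longrightarrow> Q e \<longleftrightarrow> Q1 e" "\<And>e. f e \<noteq> 0 \<Longrightarrow> Q e \<longleftrightarrow> Q2 e"
  shows "constructible Q"
proof -
  have "Q = (\<lambda>e. (f e = 0 \<and> Q1 e) \<or> (\<not> f e = 0 \<and> Q2 e))"
    using assms(4,5) by fastforce
  then show ?thesis
    using assms(1-3) by (auto intro!: constructible_disj constructible.conj constructible.neg constructible.eq0)
qed

lemma dvd_pseudo_rem:
  fixes p q :: "complex poly"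
  assumes "c \<noteq> 0"
  shows "p dvd smult c q - r * p \<longleftrightarrow> p dvd q"
  by (simp add: assms dvd_diff_left_iff dvd_smult_iff)

text \<open>Where the formal leading coefficient of \<open>p e\<close> vanishes, \<open>p\<close> is
  truncated. Elsewhere its degree is exactly \<open>d\<close>: pseudo-division lowers the bound of
  \<open>q\<close> without affecting divisibility, and once that bound is at most \<open>d\<close>,
  only \<open>q e = 0\<close> is divisible by \<open>p e\<close>.\<close>

lemma constructible_poly_family_dvd: "poly_family b p \<Longrightarrow> poly_family m q \<Longrightarrow> constructible (\<lambda>e. p e dvd q e)"
proof (induction b arbitrary: p q m)
  case 0
  then have "p e = 0" for e by (auto simp: poly_family_def poly_eq_iff)
  then show ?case using constructible_poly_family_zero[OF 0(2)] by simp
next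
  case (Suc d)
  note p = Suc.prems(1)
  have "constructible (\<lambda>e. coeff (p e) d \<noteq> 0 \<and> p e dvd q e)"
    using Suc.prems(2)
  proof (induction m arbitrary: q)
    case 0
    then have "q e = 0" for e by (auto simp: poly_family_def poly_eq_iff)
    then show ?case using constructible_coeff_nz[OF p] by simp
  next
    case (Suc m)
    show ?case
    proof (cases "d \<le> m")
      case True
      have eq: "(coeff (p e) d \<noteq> 0 \<and> p e dvd smult (coeff (p e) d) (q e) - monom (coeff (q e) m) (m - d) * p e)
          \<longleftrightarrow> (coeff (p e) d \<noteq> 0 \<and> p e dvd q e)" for e
        using dvd_pseudo_rem by blast
      show ?thesis
        using Suc.IH[OF poly_family_pseudo_rem[OF p Suc.prems True]] unfolding eq .
    next
      case False
      have "q e = 0" if "coeff (p e) d \<noteq> 0" "p e dvd q e" for e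
      proof (rule ccontr)
        assume "q e \<noteq> 0"
        with that have "degree (p e) \<le> degree (q e)" by (simp add: dvd_imp_degree_le)
        moreover have "d \<le> degree (p e)" using that by (simp add: le_degree)
        moreover have "degree (q e) \<le> m"
          using Suc.prems by (intro degree_le) (auto simp: poly_family_def)
        ultimately show False using False by simp
      qed
      then have "(coeff (p e) d \<noteq> 0 \<and> p e dvd q e) \<longleftrightarrow> coeff (p e) d \<noteq> 0 \<and> q e = 0" for e
        by auto
      then show ?thesis
        using constructible.conj[OF constructible_coeff_nz[OF p] constructible_poly_family_zero[OF Suc.prems]] by simp
    qed
  qed
  from constructible_split[OF poly_family_coeff[OF p, of d] Suc.IH[OF poly_family_truncate[OF p] Suc.prems(2)] this]
  show ?case by simp
qed

text \<open>
  Pseudo-division reduces the system to a single equation \<open>p = 0\<close> of known degree \<open>d\<close>, and then \<open>p\<close> has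
  a root outside the zeros of \<open>q\<close> iff \<open>p\<close> does not divide \<open>q ^ d\<close>.
\<close>

lemma constructible_ex_common_root:
  assumes "\<forall>(p, b) \<in> set ps. poly_family b p" "poly_family c q"
  shows "constructible (\<lambda>e. \<exists>z. (\<forall>(p, b) \<in> set ps. poly (p e) z = 0) \<and> poly (q e) z \<noteq> 0)"
  using assms(1)
\<comment> \<open>Counting \<open>Suc b\<close> instead of \<open>b\<close> makes the measure drop
  also when a family of bound 0, which is identically zero, is discarded.\<close>
proof (induction "\<Sum>(p, b)\<leftarrow>ps. Suc b" arbitrary: ps rule: less_induct)
  case (less ps)
  have drop: "constructible (\<lambda>e. \<exists>z. (\<forall>(p, b) \<in> set ((p, 0) # rs). poly (p e) z = 0) \<and> poly (q e) z \<noteq> 0)"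
    if "ps = (p, 0) # rs" for p rs
  proof -
    have "p e = 0" for e using less.prems that by (auto simp: poly_family_def poly_eq_iff)
    then show ?thesis using less.hyps[of rs] less.prems that by auto
  qed
  have trunc: "constructible (\<lambda>e. \<exists>z. (\<forall>(p, b) \<in> set ((p, Suc d) # rs). poly (p e) z = 0) \<and> poly (q e) z \<noteq> 0)"
    if "set ps = set ((p, Suc d) # rs)" "(\<Sum>(p, b)\<leftarrow>ps. Suc b) = (\<Sum>(p, b)\<leftarrow>(p, Suc d) # rs. Suc b)"
      and *: "constructible (\<lambda>e. coeff (p e) d \<noteq> 0 \<and> (\<exists>z. (\<forall>(p, b) \<in> set ((p, Suc d) # rs). poly (p e) z = 0) \<and> poly (q e) z \<noteq> 0))"
    for p d rs
  proof (rule constructible_split[OF _ _ *])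
    have p: "poly_family (Suc d) p" using less.prems that by auto
    let ?p = "\<lambda>e. p e - monom (coeff (p e) d) d"
    show "constructible (\<lambda>e. \<exists>z. (\<forall>(p, b) \<in> set ((?p, d) # rs). poly (p e) z = 0) \<and> poly (q e) z \<noteq> 0)"
      by (rule less.hyps) (use that less.prems poly_family_truncate[OF p] in auto)
    show "(\<lambda>e. coeff (p e) d) \<in> poly_funs" using poly_family_coeff[OF p] .
  qed auto
  have two: "constructible (\<lambda>e. \<exists>z. (\<forall>(p, b) \<in> set ((p, b) # (r, m) # rs). poly (p e) z = 0) \<and> poly (q e) z \<noteq> 0)"
    if ps: "set ps = set ((p, b) # (r, m) # rs)"
      "(\<Sum>(p, b)\<leftarrow>ps. Suc b) = (\<Sum>(p, b)\<leftarrow>(p, b) # (r, m) # rs. Suc b)" and "b \<le> m" for p b r m rs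
  proof (cases b)
    case 0
    have "p e = 0" for e using less.prems that 0 by (auto simp: poly_family_def poly_eq_iff)
    then show ?thesis using less.hyps[of "(r, m) # rs"] less.prems that by auto
  next
    case (Suc d)
    then obtain k where k: "m = Suc k" "d \<le> k" using \<open>b \<le> m\<close> by (cases m) auto
    have p: "poly_family (Suc d) p" and r: "poly_family (Suc k) r" using less.prems that Suc k by auto
    \<comment> \<open>Where the leading coefficient of \<open>p e\<close> is nonzero,
      \<open>p\<close> and \<open>?r\<close> have the same common zeros as \<open>p\<close> and
      \<open>r\<close>, and the bound of \<open>?r\<close> is one lower.\<close>
    let ?r = "\<lambda>e. smult (coeff (p e) d) (r e) - monom (coeff (r e) k) (k - d) * p e"
    have "constructible (\<lambda>e. \<exists>z. (\<forall>(p, b) \<in> set ((p, Suc d) # (?r, k) # rs). poly (p e) z = 0) \<and> poly (q e) z \<noteq> 0)"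
      by (rule less.hyps) (use that k Suc less.prems poly_family_pseudo_rem[OF p r k(2)] in auto)
    then have "constructible (\<lambda>e. coeff (p e) d \<noteq> 0 \<and> (\<exists>z. (\<forall>(p, b) \<in> set ((p, Suc d) # (?r, k) # rs). poly (p e) z = 0) \<and> poly (q e) z \<noteq> 0))"
      by (rule constructible.conj[OF constructible_coeff_nz[OF p]])
    also have "(\<lambda>e. coeff (p e) d \<noteq> 0 \<and> (\<exists>z. (\<forall>(p, b) \<in> set ((p, Suc d) # (?r, k) # rs). poly (p e) z = 0) \<and> poly (q e) z \<noteq> 0)) =
       (\<lambda>e. coeff (p e) d \<noteq> 0 \<and> (\<exists>z. (\<forall>(p, b) \<in> set ((p, Suc d) # (r, m) # rs). poly (p e) z = 0) \<and> poly (q e) z \<noteq> 0))"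
      by (rule ext) (auto intro!: exI)
    finally show ?thesis unfolding Suc by (intro trunc) (use ps Suc in auto)
  qed
  show ?case
  proof (cases ps)
    case Nil
    have "(\<exists>z. poly (q e) z \<noteq> 0) \<longleftrightarrow> q e \<noteq> 0" for e
      using poly_all_0_iff_0 by blast
    then show ?thesis using Nil constructible.neg[OF constructible_poly_family_zero[OF assms(2)]] by simp
  next
    case (Cons pb rs)
    obtain p b where pb: "pb = (p, b)" by (cases pb)
    show ?thesis
    proof (cases rs)
      case Nil
      show ?thesis
      proof (cases b)
        case 0
        with drop[of p rs] Cons pb show ?thesis by simp
      next
        case (Suc d)
        have p: "poly_family (Suc d) p" using less.prems Cons pb Suc by auto
        have "(\<exists>z. poly (p e) z = 0 \<and> poly (q e) z \<noteq> 0) \<longleftrightarrow> \<not> p e dvd q e ^ d"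
          if "coeff (p e) d \<noteq> 0" for e
        proof -
          have "degree (p e) = d"
            using p that by (intro antisym degree_le le_degree) (auto simp: poly_family_def)
          then show ?thesis
            using nullstellensatz_univariate[of "p e" "q e"] that by auto
        qed
        then have eq: "(\<lambda>e. coeff (p e) d \<noteq> 0 \<and> (\<exists>z. poly (p e) z = 0 \<and> poly (q e) z \<noteq> 0)) =
          (\<lambda>e. coeff (p e) d \<noteq> 0 \<and> \<not> p e dvd q e ^ d)"
          by (intro ext conj_cong refl)
        obtain c' where "poly_family c' (\<lambda>e. q e ^ d)" using poly_family_power[OF assms(2)] by blast
        then have "constructible (\<lambda>e. coeff (p e) d \<noteq> 0 \<and> \<not> p e dvd q e ^ d)"
          by (intro constructible.conj[OF constructible_coeff_nz[OF p]] constructible.neg constructible_poly_family_dvd[OF p])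
        then show ?thesis
          using trunc[of p d rs] Cons pb Nil Suc eq by simp
      qed
    next
      case (Cons rm rs')
      obtain r m where rm: "rm = (r, m)" by (cases rm)
      show ?thesis
      proof (cases "b \<le> m")
        case True
        then show ?thesis using two[of p b r m rs'] Cons \<open>ps = pb # rs\<close> pb rm by simp
      next
        case False
        have "set ps = set ((r, m) # (p, b) # rs')" using Cons \<open>ps = pb # rs\<close> pb rm by auto
        then show ?thesis using two[of r m p b rs'] False Cons \<open>ps = pb # rs\<close> pb rm by simp
      qed
    qed
  qed
qed

lemma poly_funs_as_poly_family:
  assumes "f \<in> poly_funs"
  shows "\<exists>p b. poly_family b p \<and> (\<forall>e z. f (e(n := z)) = poly (p e) z)"
  using assms
proof induction
  case (const c)
  show ?case
    by (rule exI[of _ "\<lambda>_. [:c:]"], rule exI[of _ 1])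
      (auto simp: poly_family_def coeff_pCons split: nat.split intro: fun_alg.const)
next
  case (gen g)
  then obtain m where g: "g = (\<lambda>e. e m)" by auto
  show ?case
  proof (cases "m = n")
    case True
    then show ?thesis
      using poly_family_monom[OF fun_alg.const[of 1], of 1] g
      by (intro exI[of _ "\<lambda>_. monom 1 1"] exI[of _ 2]) (auto simp: poly_monom numeral_2_eq_2)
  next
    case False
    then show ?thesis
      using poly_family_monom[OF poly_funs_var[of m], of 0] g
      by (intro exI[of _ "\<lambda>e. monom (e m) 0"] exI[of _ 1]) (auto simp: poly_monom)
  qed
next
  case (add f g)
  then show ?case by (metis poly_family_add poly_add)
next
  case (mult f g)
  then show ?case by (metis poly_family_mult poly_mult)
qed

text \<open>One inequation per disjunct suffices, since several merge into the inequation for their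
  product. This is the shape of system handled by
  \<open>constructible_ex_common_root\<close>.\<close>

definition dnf :: "((nat \<Rightarrow> complex) \<Rightarrow> bool) \<Rightarrow> bool" where
  "dnf Q \<longleftrightarrow> (\<exists>L. finite L \<and> (\<forall>(fs, g)\<in>L. set fs \<subseteq> poly_funs \<and> g \<in> poly_funs) \<and>
     (\<forall>e. Q e \<longleftrightarrow> (\<exists>(fs, g)\<in>L. (\<forall>f\<in>set fs. f e = 0) \<and> g e \<noteq> 0)))"

lemma dnf_disj:
  assumes "dnf Q" "dnf R" shows "dnf (\<lambda>e. Q e \<or> R e)"
proof -
  obtain L where "finite L" "\<forall>(fs, g)\<in>L. set fs \<subseteq> poly_funs \<and> g \<in> poly_funs"
    "\<forall>e. Q e \<longleftrightarrow> (\<exists>(fs, g)\<in>L. (\<forall>f\<in>set fs. f e = 0) \<and> g e \<noteq> 0)"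
    using assms(1) unfolding dnf_def by blast
  moreover obtain K where "finite K" "\<forall>(fs, g)\<in>K. set fs \<subseteq> poly_funs \<and> g \<in> poly_funs"
    "\<forall>e. R e \<longleftrightarrow> (\<exists>(fs, g)\<in>K. (\<forall>f\<in>set fs. f e = 0) \<and> g e \<noteq> 0)"
    using assms(2) unfolding dnf_def by blast
  ultimately show ?thesis
    unfolding dnf_def by (intro exI[of _ "L \<union> K"]) (simp add: bex_Un ball_Un)
qed

lemma dnf_conj:
  assumes "dnf Q" "dnf R" shows "dnf (\<lambda>e. Q e \<and> R e)"
proof -
  obtain L where L: "finite L" "\<forall>(fs, g)\<in>L. set fs \<subseteq> poly_funs \<and> g \<in> poly_funs"
    "\<forall>e. Q e \<longleftrightarrow> (\<exists>(fs, g)\<in>L. (\<forall>f\<in>set fs. f e = 0) \<and> g e \<noteq> 0)"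
    using assms(1) unfolding dnf_def by blast
  obtain K where K: "finite K" "\<forall>(fs, g)\<in>K. set fs \<subseteq> poly_funs \<and> g \<in> poly_funs"
    "\<forall>e. R e \<longleftrightarrow> (\<exists>(fs, g)\<in>K. (\<forall>f\<in>set fs. f e = 0) \<and> g e \<noteq> 0)"
    using assms(2) unfolding dnf_def by blast
  let ?LK = "(\<lambda>((fs, g), (fs', g')). (fs @ fs', \<lambda>e. g e * g' e)) ` (L \<times> K)"
  show ?thesis
    unfolding dnf_def
  proof (rule exI[of _ ?LK], intro conjI allI)
    show "finite ?LK" using L K by auto
    show "\<forall>(fs, g)\<in>?LK. set fs \<subseteq> poly_funs \<and> g \<in> poly_funs"
      using L(2) K(2) by (fastforce intro: fun_alg.mult)
    show "(Q e \<and> R e) \<longleftrightarrow> (\<exists>(fs, g)\<in>?LK. (\<forall>f\<in>set fs. f e = 0) \<and> g e \<noteq> 0)" for e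
      using L(3) K(3) by (simp add: ball_Un split_beta) blast
  qed
qed

text \<open>With the normal form of the complement carried through the induction, negation merely
  swaps the two halves.\<close>

lemma constructible_imp_dnf: "constructible Q \<Longrightarrow> dnf Q \<and> dnf (\<lambda>e. \<not> Q e)"
proof (induction rule: constructible.induct)
  case (eq0 f)
  have "dnf (\<lambda>e. f e = 0)"
    unfolding dnf_def by (rule exI[of _ "{([f], \<lambda>_. 1)}"]) (use eq0 in \<open>auto intro: fun_alg.const\<close>)
  moreover have "dnf (\<lambda>e. f e \<noteq> 0)"
    unfolding dnf_def by (rule exI[of _ "{([], f)}"]) (use eq0 in auto)
  ultimately show ?case by simp
next
  case (conj Q R)
  then show ?case using dnf_disj[of "\<lambda>e. \<not> Q e" "\<lambda>e. \<not> R e"] dnf_conj[of Q R] by simp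
qed simp

text \<open>Chevalley's theorem, one variable at a time: the quantifier distributes over the
  disjuncts, and each disjunct is a system in \<open>z\<close> with coefficients polynomial in
  \<open>e\<close>.\<close>

lemma constructible_ex:
  assumes "constructible Q"
  shows "constructible (\<lambda>e. \<exists>z. Q (e(n := z)))"
proof -
  obtain L where L: "finite L" "\<forall>(fs, g)\<in>L. set fs \<subseteq> poly_funs \<and> g \<in> poly_funs"
    "\<forall>e. Q e \<longleftrightarrow> (\<exists>(fs, g)\<in>L. (\<forall>f\<in>set fs. f e = 0) \<and> g e \<noteq> 0)"
    using constructible_imp_dnf[OF assms, THEN conjunct1] unfolding dnf_def by blast
  have *: "constructible (\<lambda>e. \<exists>z. (\<forall>f\<in>set fs. f (e(n := z)) = 0) \<and> g (e(n := z)) \<noteq> 0)"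
    if fs: "set fs \<subseteq> poly_funs" and g: "g \<in> poly_funs" for fs g
  proof -
    obtain p b where pb: "\<And>f. f \<in> poly_funs \<Longrightarrow> poly_family (b f) (p f) \<and> (\<forall>e z. f (e(n := z)) = poly (p f e) z)"
      using poly_funs_as_poly_family[where n = n] by metis
    have "constructible (\<lambda>e. \<exists>z. (\<forall>(p, b) \<in> set (map (\<lambda>f. (p f, b f)) fs). poly (p e) z = 0) \<and> poly (p g e) z \<noteq> 0)"
      by (rule constructible_ex_common_root[where c = "b g"]) (use pb fs g in auto)
    also have "(\<lambda>e. \<exists>z. (\<forall>(p, b) \<in> set (map (\<lambda>f. (p f, b f)) fs). poly (p e) z = 0) \<and> poly (p g e) z \<noteq> 0) =
        (\<lambda>e. \<exists>z. (\<forall>f\<in>set fs. f (e(n := z)) = 0) \<and> g (e(n := z)) \<noteq> 0)"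
      using pb g fs by (auto simp: fun_eq_iff subset_iff)
    finally show ?thesis .
  qed
  have "constructible (\<lambda>e. \<exists>i\<in>L. \<exists>z. (\<forall>f\<in>set (fst i). f (e(n := z)) = 0) \<and> snd i (e(n := z)) \<noteq> 0)"
    by (intro constructible_Bex[OF L(1)] *) (use L(2) in \<open>auto simp: split_beta\<close>)
  also have "(\<lambda>e. \<exists>i\<in>L. \<exists>z. (\<forall>f\<in>set (fst i). f (e(n := z)) = 0) \<and> snd i (e(n := z)) \<noteq> 0) =
      (\<lambda>e. \<exists>z. Q (e(n := z)))"
    using L(3) by (auto simp: fun_eq_iff split_beta)
  finally show ?thesis .
qed

lemma constructible_sat: "constructible (\<lambda>e. sat e p)"
proof (induction p)
  case (REq s t)
  have "(\<lambda>e. term_val e u) \<in> poly_funs" for u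
    by (induction u) (auto intro: fun_alg.const fun_alg.add fun_alg.mult fun_alg_diff poly_funs_var)
  then show ?case by (simp add: constructible_eq)
qed (auto intro: constructible.intros constructible_ex)

section \<open>Saturation\<close>

lemma constructible_update:
  assumes "constructible Q" shows "constructible (\<lambda>e. Q (e(n := c)))"
proof (rule constructible_compose[OF assms])
  show "(\<lambda>e. (e(n := c)) m) \<in> poly_funs" for m
    by (cases "m = n") (auto intro: fun_alg.const poly_funs_var)
qed

lemma constructible_finite_or_cofinite:
  assumes "constructible Q" shows "finite {z. Q (e(n := z))} \<or> finite {z. \<not> Q (e(n := z))}"
  using assms
proof induction
  case (eq0 f)
  obtain p b where pb: "\<And>e z. f (e(n := z)) = poly (p e) z"
    using poly_funs_as_poly_family[OF eq0, of n] by auto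
  show ?case
    using poly_roots_finite[of "p e"] by (cases "p e = 0") (simp_all add: pb del: fun_upd_apply)
next
  case (neg Q)
  then show ?case by auto
next
  case (conj Q R)
  have "{z. \<not> (Q (e(n := z)) \<and> R (e(n := z)))} = {z. \<not> Q (e(n := z))} \<union> {z. \<not> R (e(n := z))}"
    by auto
  moreover have "finite {z. Q (e(n := z)) \<and> R (e(n := z))}"
    if "finite {z. Q (e(n := z))} \<or> finite {z. R (e(n := z))}"
    using that by (auto intro: rev_finite_subset simp del: fun_upd_apply)
  ultimately show ?case using conj.IH by (metis (lifting) finite_UnI)
qed

text \<open>A set of n + 1 elements comes from an element and a set of n elements, so by induction
  the sets of each fixed size are at most as many as the elements of \<open>A\<close>; a countable
  union does not change this.\<close>

lemma infinite_Fpow_lepoll: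
  includes cardinal_syntax
  assumes "infinite A" shows "Fpow A \<lesssim> A"
proof -
  define F where "F n = {X. X \<subseteq> A \<and> finite X \<and> card X = n}" for n :: nat
  have "|F n| \<le>o |A|" for n
  proof (induction n)
    case 0
    have "F 0 = {{}}" by (auto simp: F_def)
    then show ?case
      using assms by (simp add: card_of_singl_ordLeq infinite_imp_nonempty)
  next
    case (Suc n)
    have "F (Suc n) \<subseteq> (\<lambda>(x, X). insert x X) ` (A \<times> F n)"
    proof
      fix X assume X: "X \<in> F (Suc n)"
      then obtain x where "x \<in> X" by (force simp: F_def)
      then have "(x, X - {x}) \<in> A \<times> F n" "insert x (X - {x}) = X"
        using X by (auto simp: F_def)
      then show "X \<in> (\<lambda>(x, X). insert x X) ` (A \<times> F n)"
        by (metis (no_types, lifting) case_prod_conv image_eqI)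
    qed
    then have "|F (Suc n)| \<le>o |A \<times> F n|"
      by (rule surj_imp_ordLeq)
    also have "|A \<times> F n| \<le>o |A \<times> A|"
      by (rule card_of_Times_mono2[OF Suc])
    also have "|A \<times> A| =o |A|"
      by (rule card_of_Times_same_infinite[OF assms])
    finally show ?case .
  qed
  then have "|\<Union>n. F n| \<le>o |A|"
    using assms infinite_iff_card_of_nat by (intro card_of_UNION_ordLeq_infinite) auto
  moreover have "Fpow A = (\<Union>n. F n)" by (auto simp: Fpow_def F_def)
  ultimately show ?thesis by (simp add: lepoll_def card_of_ordLeq)
qed

lemma Fpow_lesspoll:
  assumes "A \<prec> B" "infinite B" shows "Fpow A \<prec> B"
proof (cases "finite A")
  case True
  then have "finite (Fpow A)"
    by (meson Fpow_subset_Pow finite_Pow_iff finite_subset)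
  then show ?thesis by (rule finite_lesspoll_infinite[OF assms(2)])
next
  case False
  show ?thesis by (rule lesspoll_trans1[OF infinite_Fpow_lepoll[OF False] assms(1)])
qed

text \<open>If some \<open>A k\<close> is finite, each of its points is excluded by a single index,
  so an empty intersection would already be witnessed by finitely many indices. If all are cofinite,
  the union of the complements has cardinality at most that of \<open>J\<close> when
  \<open>J\<close> is infinite, and so misses a point.\<close>

lemma saturation_line:
  includes cardinal_syntax
  fixes A :: "'j \<Rightarrow> complex set"
  assumes J: "J \<prec> (UNIV :: complex set)"
    and A: "\<And>j. j \<in> J \<Longrightarrow> finite (A j) \<or> finite (- A j)"
    and fip: "\<And>F. finite F \<Longrightarrow> F \<subseteq> J \<Longrightarrow> (\<Inter>j\<in>F. A j) \<noteq> {}"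
  shows "(\<Inter>j\<in>J. A j) \<noteq> {}"
proof (cases "\<exists>j\<in>J. finite (A j)")
  case True
  then obtain k where k: "k \<in> J" "finite (A k)" by blast
  show ?thesis
  proof
    assume "(\<Inter>j\<in>J. A j) = {}"
    then have "\<forall>x. \<exists>j\<in>J. x \<notin> A j" by auto
    then obtain g where g: "\<And>x. g x \<in> J \<and> x \<notin> A (g x)" by metis
    then have "(\<Inter>j\<in>insert k (g ` A k). A j) \<noteq> {}" using k by (intro fip) auto
    then show False using g by auto
  qed
next
  case False
  then have fin: "finite (- A j)" if "j \<in> J" for j using A that by blast
  show ?thesis
  proof (cases "finite J")
    case True
    then show ?thesis using fip by blast
  next
    case inf: False
    have "|\<Union>j\<in>J. - A j| \<le>o |J|"
    proof (rule card_of_UNION_ordLeq_infinite[OF inf])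
      show "\<forall>j\<in>J. |- A j| \<le>o |J|"
        using fin inf by (metis card_of_ordLeq_finite card_of_ordLeq lepoll_def finite_lepoll_infinite)
    qed (rule card_of_mono1[OF subset_refl])
    then have "(\<Union>j\<in>J. - A j) \<lesssim> J" by (simp add: lepoll_def card_of_ordLeq)
    then have "(\<Union>j\<in>J. - A j) \<noteq> UNIV" using J lesspoll_trans1 by fastforce
    then show ?thesis by auto
  qed
qed

lemma constructible_ex_below: "constructible Q \<Longrightarrow> constructible (\<lambda>e. \<exists>e'. (\<forall>n\<ge>k. e' n = e n) \<and> Q e')"
proof (induction k)
  case 0
  have "(\<forall>n. e' n = e n) \<longleftrightarrow> e' = e" for e' e :: "nat \<Rightarrow> complex" by auto
  then show ?case using 0 by simp
next
  case (Suc k)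
  have "(\<lambda>e. \<exists>e'. (\<forall>n\<ge>Suc k. e' n = e n) \<and> Q e') =
    (\<lambda>e. \<exists>z. \<exists>e'. (\<forall>n\<ge>k. e' n = (e(k := z)) n) \<and> Q e')"
  proof (intro ext iffI)
    fix e assume "\<exists>e'. (\<forall>n\<ge>Suc k. e' n = e n) \<and> Q e'"
    then obtain e' where e': "\<forall>n\<ge>Suc k. e' n = e n" "Q e'" by blast
    then have "\<forall>n\<ge>k. e' n = (e(k := e' k)) n" by (auto simp: Suc_le_eq)
    with e' show "\<exists>z. \<exists>e'. (\<forall>n\<ge>k. e' n = (e(k := z)) n) \<and> Q e'" by blast
  next
    fix e assume "\<exists>z. \<exists>e'. (\<forall>n\<ge>k. e' n = (e(k := z)) n) \<and> Q e'"
    then obtain z e' where e': "\<forall>n\<ge>k. e' n = (e(k := z)) n" "Q e'" by blast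
    then have "\<forall>n\<ge>Suc k. e' n = e n" by auto
    with e' show "\<exists>e'. (\<forall>n\<ge>Suc k. e' n = e n) \<and> Q e'" by blast
  qed
  then show ?case using constructible_ex[OF Suc.IH[OF Suc.prems]] by presburger
qed

text \<open>Induction on the number of free coordinates; the others are pinned to 0, and parameters
  sit inside \<open>Q\<close>. The value \<open>z\<close> of the last free coordinate must leave
  every finite subsystem solvable. These requirements \<open>A F\<close> are indexed by
  \<open>Fpow I\<close>, which is still smaller than the continuum, and by quantifier elimination
  each is finite or cofinite.\<close>

lemma saturation:
  assumes I: "I \<prec> (UNIV :: complex set)"
    and "\<And>i. i \<in> I \<Longrightarrow> constructible (Q i)"
    and "\<And>F. F \<in> Fpow I \<Longrightarrow> \<exists>e. (\<forall>n\<ge>k. e n = 0) \<and> (\<forall>i\<in>F. Q i e)"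
  shows "\<exists>e. (\<forall>n\<ge>k. e n = 0) \<and> (\<forall>i\<in>I. Q i e)"
  using assms(2,3)
proof (induction k arbitrary: Q)
  case 0
  have "Q i (\<lambda>_. 0)" if i: "i \<in> I" for i
  proof -
    have "{i} \<in> Fpow I" using i by (auto simp: Fpow_def)
    then obtain e where e: "\<forall>n. e n = 0" "Q i e" using 0(2)[of "{i}"] by auto
    then have "e = (\<lambda>_. 0)" by auto
    then show ?thesis using e by simp
  qed
  then show ?case by auto
next
  case (Suc k)
  define A where "A F = {z. \<exists>e'. (\<forall>n\<ge>k. e' n = ((\<lambda>_. 0)(k := z)) n) \<and> (\<forall>i\<in>F. Q i e')}" for F
  have constructible: "constructible (\<lambda>e. \<forall>i\<in>F. Q i e)" if "F \<in> Fpow I" for F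
    using that Suc.prems(1) by (intro constructible_Ball) (auto simp: Fpow_def)
  have "(\<Inter>F\<in>Fpow I. A F) \<noteq> {}"
  proof (rule saturation_line)
    show "Fpow I \<prec> (UNIV :: complex set)"
      by (rule Fpow_lesspoll[OF I]) (rule infinite_UNIV_char_0)
    show "finite (A F) \<or> finite (- A F)" if "F \<in> Fpow I" for F
    proof -
      have "- A F = {z. \<not> (\<exists>e'. (\<forall>n\<ge>k. e' n = ((\<lambda>_. 0)(k := z)) n) \<and> (\<forall>i\<in>F. Q i e'))}"
        by (auto simp: A_def)
      then show ?thesis
        using constructible_finite_or_cofinite[OF constructible_ex_below[OF constructible[OF that]], where e = "\<lambda>_. 0" and n = k] A_def by simp
    qed
    fix \<F> assume \<F>: "finite \<F>" "\<F> \<subseteq> Fpow I"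
    then have "\<Union>\<F> \<in> Fpow I" by (auto simp: Fpow_def)
    then obtain e where e: "\<forall>n\<ge>Suc k. e n = 0" "\<forall>i\<in>\<Union>\<F>. Q i e"
      using Suc.prems(2) by blast
    then have "\<forall>n\<ge>k. e n = ((\<lambda>_. 0)(k := e k)) n" by (auto simp: Suc_le_eq)
    then have "e k \<in> A F" if "F \<in> \<F>" for F using that e unfolding A_def by blast
    then show "(\<Inter>F\<in>\<F>. A F) \<noteq> {}" by auto
  qed
  then obtain z where z: "\<And>F. F \<in> Fpow I \<Longrightarrow> z \<in> A F" by blast
  have "\<exists>e. (\<forall>n\<ge>k. e n = 0) \<and> (\<forall>i\<in>I. Q i (e(k := z)))"
  proof (rule Suc.IH)
    show "constructible (\<lambda>e. Q i (e(k := z)))" if "i \<in> I" for i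
      by (rule constructible_update[OF Suc.prems(1)[OF that]])
    fix F assume "F \<in> Fpow I"
    then obtain e where e: "\<forall>n\<ge>k. e n = ((\<lambda>_. 0)(k := z)) n" "\<forall>i\<in>F. Q i e"
      using z unfolding A_def by blast
    then have "(e(k := 0))(k := z) = e" by auto
    then show "\<exists>e. (\<forall>n\<ge>k. e n = 0) \<and> (\<forall>i\<in>F. Q i (e(k := z)))"
      using e by (intro exI[of _ "e(k := 0)"]) auto
  qed
  then obtain e where e: "\<forall>n\<ge>k. e n = 0" "\<forall>i\<in>I. Q i (e(k := z))" by blast
  then have "(\<forall>n\<ge>Suc k. (e(k := z)) n = 0)" by auto
  with e show ?case by blast
qed

text \<open>
  Matrix variables are de Bruijn indices: variable number \<open>k\<close> is \<open>mat_of (4 * k)\<close>, and a matrix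
  quantifier shifts the environment by 4.
\<close>

definition mat_of :: "nat \<Rightarrow> (nat \<Rightarrow> complex) \<Rightarrow> mat2" where
  "mat_of k e = (\<chi> i j. e (k + (if i = 1 then 0 else 2) + (if j = 1 then 0 else 1)))"

definition mterm :: "((nat \<Rightarrow> complex) \<Rightarrow> mat2) \<Rightarrow> bool" where
  "mterm t \<longleftrightarrow> (\<forall>i j. (\<lambda>e. t e $ i $ j) \<in> poly_funs)"

lemma mterm_const: "mterm (\<lambda>_. A)"
  by (simp add: mterm_def fun_alg.const)

lemma mterm_mat_of: "mterm (mat_of k)"
  by (simp add: mterm_def mat_of_def poly_funs_var)

lemma mterm_mult: "mterm s \<Longrightarrow> mterm t \<Longrightarrow> mterm (\<lambda>e. s e ** t e)"
  unfolding mterm_def matrix_matrix_mult_def by (auto intro!: fun_alg_sum fun_alg.mult)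

lemma constructible_mat_eq: "mterm s \<Longrightarrow> mterm t \<Longrightarrow> constructible (\<lambda>e. s e = t e)"
  unfolding mterm_def vec_eq_iff forall_2 by (intro constructible.conj constructible_eq) auto

text \<open>The working form of \<open>definable_mat\<close>, shown equivalent in
  \<open>definable_mat_iff_defm\<close>; it passes through polynomial substitutions without renaming
  variables.\<close>

definition defm :: "mat2 set \<Rightarrow> bool" where
  "defm X \<longleftrightarrow> constructible (\<lambda>e. mat_of 0 e \<in> X)"

lemma constructible_mem:
  assumes "defm X" "mterm t" shows "constructible (\<lambda>e. t e \<in> X)"
proof -
  define s :: "(nat \<Rightarrow> complex) \<Rightarrow> nat \<Rightarrow> complex" where
    "s e n = (if n = 0 then t e $ 1 $ 1 else if n = 1 then t e $ 1 $ 2 else if n = 2 then t e $ 2 $ 1 else t e $ 2 $ 2)"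
    for e n
  have "(\<lambda>e. s e n) \<in> poly_funs" for n
    using assms(2) unfolding s_def mterm_def
    by (cases "n = 0"; cases "n = 1"; cases "n = 2") simp_all
  then have "constructible (\<lambda>e. mat_of 0 (s e) \<in> X)"
    using constructible_compose assms(1) unfolding defm_def by blast
  moreover have "mat_of 0 (s e) = t e" for e
    by (simp add: mat_of_def s_def vec_eq_iff forall_2)
  ultimately show ?thesis by simp
qed

lemma constructible_ex_mat:
  assumes "constructible (\<lambda>e. Q (\<lambda>n. e (n + 4)) (mat_of 0 e))"
  shows "constructible (\<lambda>e. \<exists>A. Q e A)"
proof -
  have "constructible (\<lambda>e. \<exists>e'. (\<forall>n\<ge>4. e' n = e n) \<and> Q (\<lambda>n. e' (n + 4)) (mat_of 0 e'))"
    by (rule constructible_ex_below[OF assms])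
  \<comment> \<open>Replacing index \<open>n\<close> by \<open>n - 4\<close> undoes the shift of the
    environment; truncated subtraction does no harm because only indices from 4 on are
    consulted.\<close>
  then have "constructible (\<lambda>e. \<exists>e'. (\<forall>n\<ge>4. e' n = e (n - 4)) \<and> Q (\<lambda>n. e' (n + 4)) (mat_of 0 e'))"
    by (rule constructible_compose) (rule poly_funs_var)
  moreover have "(\<exists>e'. (\<forall>n\<ge>4. e' n = e (n - 4)) \<and> Q (\<lambda>n. e' (n + 4)) (mat_of 0 e')) \<longleftrightarrow> (\<exists>A. Q e A)" for e
  proof safe
    fix e' :: "nat \<Rightarrow> complex" assume *: "\<forall>n\<ge>4. e' n = e (n - 4)" "Q (\<lambda>n. e' (n + 4)) (mat_of 0 e')"
    then have "(\<lambda>n. e' (n + 4)) = e" by auto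
    then show "\<exists>A. Q e A" using * by auto
  next
    fix A assume A: "Q e A"
    define e' where "e' n = (if n = 0 then A $ 1 $ 1 else if n = 1 then A $ 1 $ 2 else if n = 2 then A $ 2 $ 1
      else if n = 3 then A $ 2 $ 2 else e (n - 4))" for n
    have "mat_of 0 e' = A" by (simp add: mat_of_def e'_def vec_eq_iff forall_2)
    moreover have "(\<lambda>n. e' (n + 4)) = e" by (auto simp: e'_def)
    ultimately show "\<exists>e'. (\<forall>n\<ge>4. e' n = e (n - 4)) \<and> Q (\<lambda>n. e' (n + 4)) (mat_of 0 e')"
      using A by (intro exI[of _ e']) (auto simp: e'_def)
  qed
  ultimately show ?thesis by simp
qed

lemma constructible_all_mat:
  assumes "constructible (\<lambda>e. Q (\<lambda>n. e (n + 4)) (mat_of 0 e))"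
  shows "constructible (\<lambda>e. \<forall>A. Q e A)"
  using constructible.neg[OF constructible_ex_mat[of "\<lambda>e A. \<not> Q e A"]] constructible.neg[OF assms] by simp

lemma constructible_ball_mat:
  assumes "defm X" "constructible (\<lambda>e. Q (\<lambda>n. e (n + 4)) (mat_of 0 e))"
  shows "constructible (\<lambda>e. \<forall>A\<in>X. Q e A)"
  unfolding Ball_def using assms by (intro constructible_all_mat constructible_imp constructible_mem mterm_mat_of)

lemma defm_Inter: "finite F \<Longrightarrow> (\<And>X. X \<in> F \<Longrightarrow> defm X) \<Longrightarrow> defm (\<Inter>F)"
  unfolding defm_def Inter_iff by (rule constructible_Ball)

lemma saturation_mat:
  assumes I: "I \<prec> (UNIV :: complex set)"
    and "\<And>i. i \<in> I \<Longrightarrow> constructible (\<lambda>e. Q i (mat_of 0 e) (mat_of 4 e))"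
    and fip: "\<And>F. F \<in> Fpow I \<Longrightarrow> \<exists>A B. \<forall>i\<in>F. Q i A B"
  shows "\<exists>A B. \<forall>i\<in>I. Q i A B"
proof -
  have "\<exists>e. (\<forall>n\<ge>8. e n = 0) \<and> (\<forall>i\<in>I. Q i (mat_of 0 e) (mat_of 4 e))"
  proof (rule saturation[OF assms(1,2)])
    fix F assume "F \<in> Fpow I"
    then obtain A B where AB: "\<forall>i\<in>F. Q i A B" using fip by blast
    define e where "e n = (if n = 0 then A $ 1 $ 1 else if n = 1 then A $ 1 $ 2 else if n = 2 then A $ 2 $ 1
      else if n = 3 then A $ 2 $ 2 else if n = 4 then B $ 1 $ 1 else if n = 5 then B $ 1 $ 2
      else if n = 6 then B $ 2 $ 1 else if n = 7 then B $ 2 $ 2 else 0)" for n :: nat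
    have "mat_of 0 e = A" "mat_of 4 e = B"
      by (simp_all add: mat_of_def e_def vec_eq_iff forall_2)
    then show "\<exists>e. (\<forall>n\<ge>8. e n = 0) \<and> (\<forall>i\<in>F. Q i (mat_of 0 e) (mat_of 4 e))"
      using AB by (intro exI[of _ e]) (auto simp: e_def)
  qed
  then show ?thesis by blast
qed

lemma compactness_mat:
  assumes \<D>: "\<D> \<prec> (UNIV :: complex set)" "\<And>D. D \<in> \<D> \<Longrightarrow> defm D"
    and constructible: "constructible (\<lambda>e. Q (mat_of 0 e) (mat_of 4 e))"
    and Q: "\<And>A B. A \<in> \<Inter>\<D> \<Longrightarrow> B \<in> \<Inter>\<D> \<Longrightarrow> Q A B"
  obtains D where "defm D" "\<Inter>\<D> \<subseteq> D" "\<And>A B. A \<in> D \<Longrightarrow> B \<in> D \<Longrightarrow> Q A B"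
proof -
  have "\<exists>F\<in>Fpow \<D>. \<forall>A\<in>\<Inter>F. \<forall>B\<in>\<Inter>F. Q A B"
  proof (rule ccontr)
    assume *: "\<not> ?thesis"
    have "\<exists>A B. \<forall>D\<in>\<D>. A \<in> D \<and> B \<in> D \<and> \<not> Q A B"
    proof (rule saturation_mat[OF \<D>(1)])
      show "constructible (\<lambda>e. mat_of 0 e \<in> D \<and> mat_of 4 e \<in> D \<and> \<not> Q (mat_of 0 e) (mat_of 4 e))" if "D \<in> \<D>" for D
        by (intro constructible.conj constructible_mem \<D>(2)[OF that] mterm_mat_of constructible.neg constructible)
      show "\<exists>A B. \<forall>D\<in>F. A \<in> D \<and> B \<in> D \<and> \<not> Q A B" if "F \<in> Fpow \<D>" for F
      proof -
        from * that have "\<not> (\<forall>A\<in>\<Inter>F. \<forall>B\<in>\<Inter>F. Q A B)" by metis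
        then obtain A B where "A \<in> \<Inter>F" "B \<in> \<Inter>F" "\<not> Q A B" by meson
        then show ?thesis by (intro exI[of _ A] exI[of _ B] ballI conjI) (auto elim: InterD)
      qed
    qed
    then obtain A B where AB: "\<forall>D\<in>\<D>. A \<in> D \<and> B \<in> D \<and> \<not> Q A B" by blast
    then have "A \<in> \<Inter>\<D>" "B \<in> \<Inter>\<D>" by auto
    then have "Q A B" by (rule Q)
    \<comment> \<open>The contradiction needs a member of \<open>\<D>\<close>. For the empty family
      the intersection is everything, and the empty finite subfamily already works.\<close>
    with AB have "\<D> = {}" by blast
    then have "Q A B" for A B by (intro Q) auto
    then show False using * empty_in_Fpow[of \<D>] by blast
  qed
  then obtain F where F: "F \<in> Fpow \<D>" "\<forall>A\<in>\<Inter>F. \<forall>B\<in>\<Inter>F. Q A B" by blast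
  show ?thesis
  proof (rule that[of "\<Inter>F"])
    show "defm (\<Inter>F)" using F(1) \<D>(2) by (intro defm_Inter) (auto simp: Fpow_def)
  qed (use F in \<open>auto simp: Fpow_def\<close>)
qed

section \<open>From constructible predicates back to formulas with parameters\<close>

primrec rename_term :: "(nat \<Rightarrow> nat) \<Rightarrow> ring_term \<Rightarrow> ring_term" where
  "rename_term s (RVar n) = RVar (s n)"
| "rename_term s RZero = RZero"
| "rename_term s ROne = ROne"
| "rename_term s (RAdd t u) = RAdd (rename_term s t) (rename_term s u)"
| "rename_term s (RSub t u) = RSub (rename_term s t) (rename_term s u)"
| "rename_term s (RMul t u) = RMul (rename_term s t) (rename_term s u)"

primrec rename_formula :: "(nat \<Rightarrow> nat) \<Rightarrow> ring_formula \<Rightarrow> ring_formula" where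
  "rename_formula s (REq t u) = REq (rename_term s t) (rename_term s u)"
| "rename_formula s (RNot p) = RNot (rename_formula s p)"
| "rename_formula s (RAnd p q) = RAnd (rename_formula s p) (rename_formula s q)"
| "rename_formula s (REx n p) = REx (s n) (rename_formula s p)"

lemma term_val_rename: "term_val e (rename_term s t) = term_val (\<lambda>n. e (s n)) t"
  by (induction t) auto

lemma sat_rename: "inj s \<Longrightarrow> sat e (rename_formula s p) \<longleftrightarrow> sat (\<lambda>n. e (s n)) p"
proof (induction p arbitrary: e)
  case (REx n p)
  have "(\<lambda>m. (e(s n := z)) (s m)) = (\<lambda>m. e (s m))(n := z)" for z
    using REx.prems by (auto simp: fun_eq_iff inj_eq)
  then show ?case using REx by simp
qed (auto simp: term_val_rename)

definition with_params :: "nat \<Rightarrow> (nat \<Rightarrow> complex) \<Rightarrow> (nat \<Rightarrow> complex) \<Rightarrow> nat \<Rightarrow> complex" where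
  "with_params k c e n = (if n < k then e n else c n)"

text \<open>Two parameter assignments are merged by interleaving.\<close>

lemma merge_params:
  obtains c s1 s2 where "inj s1" "inj s2"
    "\<And>e. (\<lambda>n. with_params k c e (s1 n)) = with_params k c1 e"
    "\<And>e. (\<lambda>n. with_params k c e (s2 n)) = with_params k c2 e"
proof -
  define s1 where "s1 n = (if n < k then n else k + 2 * (n - k))" for n
  define s2 where "s2 n = (if n < k then n else k + 2 * (n - k) + 1)" for n
  define c where "c n = (if even (n - k) then c1 (k + (n - k) div 2) else c2 (k + (n - k) div 2))" for n
  show ?thesis
  proof (rule that[of s1 s2 c])
    show "inj s1" by (rule injI) (auto simp: s1_def split: if_splits)
    show "inj s2" by (rule injI) (auto simp: s2_def split: if_splits)
    show "(\<lambda>n. with_params k c e (s1 n)) = with_params k c1 e" for e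
      by (auto simp: with_params_def s1_def c_def)
    show "(\<lambda>n. with_params k c e (s2 n)) = with_params k c2 e" for e
      by (auto simp: with_params_def s2_def c_def)
  qed
qed

text \<open>The language names only 0 and 1, so any other constant becomes a variable of index at
  least \<open>k\<close>, interpreted by the parameter assignment \<open>c\<close>. On the right the
  coordinates from \<open>k\<close> on are set to 0, because those indices now serve for
  parameters.\<close>

lemma poly_funs_as_term:
  assumes "f \<in> poly_funs"
  shows "\<exists>t c. \<forall>e. term_val (with_params k c e) t = f (with_params k (\<lambda>_. 0) e)"
  using assms
proof induction
  case (const a)
  show ?case by (rule exI[of _ "RVar k"], rule exI[of _ "\<lambda>_. a"]) (simp add: with_params_def)
next
  case (gen g)
  then obtain n where n: "g = (\<lambda>e. e n)" by auto
  show ?case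
    by (rule exI[of _ "RVar n"], rule exI[of _ "\<lambda>_. 0"]) (simp add: with_params_def n)
next
  case (add f g)
  then obtain t1 c1 t2 c2 where t:
      "\<And>e. term_val (with_params k c1 e) t1 = f (with_params k (\<lambda>_. 0) e)"
      "\<And>e. term_val (with_params k c2 e) t2 = g (with_params k (\<lambda>_. 0) e)" by blast
  obtain c s1 s2 where "\<And>e. (\<lambda>n. with_params k c e (s1 n)) = with_params k c1 e"
    "\<And>e. (\<lambda>n. with_params k c e (s2 n)) = with_params k c2 e"
    using merge_params[of k c1 c2] by metis
  then show ?case
    by (intro exI[of _ "RAdd (rename_term s1 t1) (rename_term s2 t2)"] exI[of _ c])
      (simp add: term_val_rename t)
next
  case (mult f g)
  then obtain t1 c1 t2 c2 where t:
      "\<And>e. term_val (with_params k c1 e) t1 = f (with_params k (\<lambda>_. 0) e)"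
      "\<And>e. term_val (with_params k c2 e) t2 = g (with_params k (\<lambda>_. 0) e)" by blast
  obtain c s1 s2 where "\<And>e. (\<lambda>n. with_params k c e (s1 n)) = with_params k c1 e"
    "\<And>e. (\<lambda>n. with_params k c e (s2 n)) = with_params k c2 e"
    using merge_params[of k c1 c2] by metis
  then show ?case
    by (intro exI[of _ "RMul (rename_term s1 t1) (rename_term s2 t2)"] exI[of _ c])
      (simp add: term_val_rename t)
qed

lemma constructible_as_formula:
  assumes "constructible Q"
  shows "\<exists>p c. \<forall>e. sat (with_params k c e) p \<longleftrightarrow> Q (with_params k (\<lambda>_. 0) e)"
  using assms
proof induction
  case (eq0 f)
  then obtain t c where "\<forall>e. term_val (with_params k c e) t = f (with_params k (\<lambda>_. 0) e)"
    using poly_funs_as_term by blast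
  then show ?case by (intro exI[of _ "REq t RZero"] exI[of _ c]) simp
next
  case (neg Q)
  then obtain p c where "\<forall>e. sat (with_params k c e) p \<longleftrightarrow> Q (with_params k (\<lambda>_. 0) e)" by blast
  then show ?case by (intro exI[of _ "RNot p"] exI[of _ c]) simp
next
  case (conj Q R)
  then obtain p1 c1 p2 c2 where t:
      "\<And>e. sat (with_params k c1 e) p1 \<longleftrightarrow> Q (with_params k (\<lambda>_. 0) e)"
      "\<And>e. sat (with_params k c2 e) p2 \<longleftrightarrow> R (with_params k (\<lambda>_. 0) e)" by blast
  obtain c s1 s2 where "inj s1" "inj s2" "\<And>e. (\<lambda>n. with_params k c e (s1 n)) = with_params k c1 e"
    "\<And>e. (\<lambda>n. with_params k c e (s2 n)) = with_params k c2 e"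
    using merge_params[of k c1 c2] by metis
  then show ?case
    by (intro exI[of _ "RAnd (rename_formula s1 p1) (rename_formula s2 p2)"] exI[of _ c])
      (simp add: sat_rename t)
qed

text \<open>From left to right this is quantifier elimination; from right to left the polynomial
  equations are written as formulas, with their coefficients as parameters.\<close>

lemma definable_mat_iff_defm: "definable_mat X \<longleftrightarrow> defm X"
proof
  assume "definable_mat X"
  then obtain p c where pc: "mat_coords ` X = {x. length x = 4 \<and> sat (\<lambda>n. if n < 4 then x ! n else c n) p}"
    unfolding definable_mat_def definable_def by blast
  have "constructible (\<lambda>e. sat (with_params 4 c e) p)"
  proof (rule constructible_compose[OF constructible_sat])
    show "(\<lambda>e. with_params 4 c e n) \<in> poly_funs" for n
      by (cases "n < 4") (auto simp: with_params_def intro: fun_alg.const poly_funs_var)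
  qed
  moreover have "sat (with_params 4 c e) p \<longleftrightarrow> mat_of 0 e \<in> X" for e
  proof -
    have "inj mat_coords" by (rule injI) (simp add: mat_coords_def vec_eq_iff forall_2)
    then have "mat_of 0 e \<in> X \<longleftrightarrow> mat_coords (mat_of 0 e) \<in> mat_coords ` X" by (simp add: inj_image_mem_iff)
    also have "mat_coords (mat_of 0 e) = [e 0, e 1, e 2, e 3]"
      by (simp add: mat_coords_def mat_of_def numeral_2_eq_2 numeral_3_eq_3)
    also have "\<dots> \<in> mat_coords ` X \<longleftrightarrow> sat (\<lambda>n. if n < 4 then [e 0, e 1, e 2, e 3] ! n else c n) p"
      unfolding pc mem_Collect_eq by (simp del: One_nat_def)
    also have "(\<lambda>n. if n < 4 then [e 0, e 1, e 2, e 3] ! n else c n) = with_params 4 c e"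
    proof
      fix n :: nat
      have "n = 0 \<or> n = 1 \<or> n = 2 \<or> n = 3 \<or> \<not> n < 4" by linarith
      then show "(if n < 4 then [e 0, e 1, e 2, e 3] ! n else c n) = with_params 4 c e n"
        by (elim disjE) (simp_all add: with_params_def)
    qed
    finally show ?thesis by simp
  qed
  ultimately show "defm X" by (simp add: defm_def)
next
  assume "defm X"
  then obtain p c where pc: "\<And>e. sat (with_params 4 c e) p \<longleftrightarrow> mat_of 0 (with_params 4 (\<lambda>_. 0) e) \<in> X"
    using constructible_as_formula unfolding defm_def by blast
  have "x \<in> mat_coords ` X \<longleftrightarrow> length x = 4 \<and> sat (\<lambda>n. if n < 4 then x ! n else c n) p" for x
  proof -
    have "(\<lambda>n. if n < 4 then x ! n else c n) = with_params 4 c ((!) x)"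
      by (auto simp: with_params_def)
    then have *: "sat (\<lambda>n. if n < 4 then x ! n else c n) p \<longleftrightarrow> mat_of 0 (with_params 4 (\<lambda>_. 0) ((!) x)) \<in> X"
      by (simp add: pc)
    show ?thesis
    proof (cases "length x = 4")
      case True
      have "x = mat_coords A \<longleftrightarrow> A = mat_of 0 (with_params 4 (\<lambda>_. 0) ((!) x))" for A
      proof -
        obtain a b c d where "x = [a, b, c, d]"
          using True by (auto simp: numeral_eq_Suc length_Suc_conv)
        then show ?thesis
          by (auto simp: mat_coords_def mat_of_def with_params_def vec_eq_iff forall_2)
      qed
      then have "x \<in> mat_coords ` X \<longleftrightarrow> mat_of 0 (with_params 4 (\<lambda>_. 0) ((!) x)) \<in> X"
        unfolding image_iff by metis
      then show ?thesis using True * by simp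
    next
      case False
      then show ?thesis by (auto simp: mat_coords_def)
    qed
  qed
  then show "definable_mat X" unfolding definable_mat_def definable_def by blast
qed

section \<open>Hilbert's basis theorem\<close>

inductive_set ideal_of :: "('a \<Rightarrow> complex) set \<Rightarrow> ('a \<Rightarrow> complex) set \<Rightarrow> ('a \<Rightarrow> complex) set"
  for R F :: "('a \<Rightarrow> complex) set" where
  zero: "(\<lambda>_. 0) \<in> ideal_of R F"
| step: "a \<in> R \<Longrightarrow> s \<in> F \<Longrightarrow> i \<in> ideal_of R F \<Longrightarrow> (\<lambda>x. a x * s x + i x) \<in> ideal_of R F"

lemma ideal_of_add:
  "f \<in> ideal_of R F \<Longrightarrow> g \<in> ideal_of R F \<Longrightarrow> (\<lambda>x. f x + g x) \<in> ideal_of R F"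
proof (induction rule: ideal_of.induct)
  case (step a s i)
  then have "(\<lambda>x. a x * s x + (i x + g x)) \<in> ideal_of R F" by (auto intro: ideal_of.step)
  then show ?case by (simp add: add.assoc)
qed simp

lemma ideal_of_mult:
  assumes "b \<in> fun_alg G" "f \<in> ideal_of (fun_alg G) F"
  shows "(\<lambda>x. b x * f x) \<in> ideal_of (fun_alg G) F"
  using assms(2)
proof (induction rule: ideal_of.induct)
  case zero
  then show ?case by (simp add: ideal_of.zero)
next
  case (step a s i)
  then have "(\<lambda>x. (b x * a x) * s x + b x * i x) \<in> ideal_of (fun_alg G) F"
    by (intro ideal_of.step fun_alg.mult assms(1))
  then show ?case by (simp add: algebra_simps)
qed

lemma ideal_of_inc: "s \<in> F \<Longrightarrow> s \<in> ideal_of (fun_alg G) F"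
  using ideal_of.step[OF fun_alg.const[of 1] _ ideal_of.zero, of s F G] by simp

lemma ideal_of_least:
  assumes "F \<subseteq> ideal_of (fun_alg G) F'"
  shows "ideal_of (fun_alg G) F \<subseteq> ideal_of (fun_alg G) F'"
proof
  fix f assume "f \<in> ideal_of (fun_alg G) F"
  then show "f \<in> ideal_of (fun_alg G) F'"
    by induction (use assms in \<open>auto intro!: ideal_of.zero ideal_of_add ideal_of_mult\<close>)
qed

lemma ideal_of_mono: "F \<subseteq> F' \<Longrightarrow> ideal_of (fun_alg G) F \<subseteq> ideal_of (fun_alg G) F'"
  by (intro ideal_of_least) (auto intro: ideal_of_inc)

lemma ideal_of_zeros:
  "f \<in> ideal_of R F \<Longrightarrow> (\<And>s. s \<in> F \<Longrightarrow> s x = 0) \<Longrightarrow> f x = 0"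
  by (induction rule: ideal_of.induct) auto

text \<open>The sequence form of the ascending chain condition. It is applied directly to the
  iterated translates of a function in \<open>zclosure_minv_mult\<close>.\<close>

definition noetherian :: "('a \<Rightarrow> complex) set \<Rightarrow> bool" where
  "noetherian R \<longleftrightarrow> (\<forall>f :: nat \<Rightarrow> _. (\<forall>n. f n \<in> R) \<longrightarrow> (\<exists>n. f n \<in> ideal_of R (f ` {..<n})))"

lemma noetherian_finite_basis:
  assumes "noetherian R" "S \<subseteq> R"
  shows "\<exists>F. finite F \<and> F \<subseteq> S \<and> S \<subseteq> ideal_of R F"
proof (rule ccontr)
  assume *: "\<not> ?thesis"
  define P where "P f n r \<longleftrightarrow> r \<in> S \<and> r \<notin> ideal_of R (f ` {..<n})" for f r and n :: nat
  have "\<exists>f. \<forall>n. P f n (f n)"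
  proof (rule dependent_wellorder_choice)
    show "P f n r = P g n r" if "\<And>m. m < n \<Longrightarrow> f m = g m" for r f g and n :: nat
    proof -
      have "f ` {..<n} = g ` {..<n}" using that by (intro image_cong) auto
      then show ?thesis by (simp add: P_def)
    qed
    show "\<exists>r. P f n r" if "\<And>m. m < n \<Longrightarrow> P f m (f m)" for f and n :: nat
    proof -
      have "finite (f ` {..<n})" "f ` {..<n} \<subseteq> S" using that by (auto simp: P_def)
      then show ?thesis using * unfolding P_def by blast
    qed
  qed
  then obtain f where f: "\<And>n :: nat. f n \<in> S" "\<And>n. f n \<notin> ideal_of R (f ` {..<n})" unfolding P_def by metis
  then have "\<forall>n. f n \<in> R" using assms(2) by auto
  then show False using assms(1) f(2) unfolding noetherian_def by blast
qed

lemma noetherian_constants: "noetherian (fun_alg {} :: ('a \<Rightarrow> complex) set)"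
  unfolding noetherian_def
proof (intro allI impI)
  fix f :: "nat \<Rightarrow> 'a \<Rightarrow> complex" assume f: "\<forall>n. f n \<in> fun_alg {}"
  have const: "\<exists>c. g = (\<lambda>_. c)" if "g \<in> fun_alg {}" for g :: "'a \<Rightarrow> complex"
    using that by induction auto
  obtain a b where ab: "f 0 = (\<lambda>_. a)" "f 1 = (\<lambda>_. b)" using f const by meson
  show "\<exists>n. f n \<in> ideal_of (fun_alg {}) (f ` {..<n})"
  proof (cases "a = 0")
    case True
    then show ?thesis using ab ideal_of.zero by (intro exI[of _ 0]) simp
  next
    case False
    have "(\<lambda>x. (b / a) * f 0 x + 0) \<in> ideal_of (fun_alg {}) (f ` {..<1})"
      by (intro ideal_of.step fun_alg.const ideal_of.zero) auto
    then show ?thesis using ab False by (intro exI[of _ 1]) simp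
  qed
qed

text \<open>This says that \<open>f\<close> is a polynomial in \<open>g\<close> of degree below
  \<open>d\<close> with coefficients in \<open>R\<close>. Since \<open>g\<close> is a function and
  not an indeterminate, neither degree nor coefficients are determined by \<open>f\<close>; hence a
  relation.\<close>

primrec deg_lt :: "('a \<Rightarrow> complex) set \<Rightarrow> ('a \<Rightarrow> complex) \<Rightarrow> nat \<Rightarrow> ('a \<Rightarrow> complex) \<Rightarrow> bool" where
  "deg_lt R g 0 f \<longleftrightarrow> f = (\<lambda>_. 0)"
| "deg_lt R g (Suc d) f \<longleftrightarrow> (\<exists>a h. a \<in> R \<and> deg_lt R g d h \<and> f = (\<lambda>x. a x * g x ^ d + h x))"

lemma deg_lt_SucI:
  "a \<in> R \<Longrightarrow> deg_lt R g d h \<Longrightarrow> (\<And>x. f x = a x * g x ^ d + h x) \<Longrightarrow> deg_lt R g (Suc d) f"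
  by auto

lemma deg_lt_add:
  "deg_lt (fun_alg G) g d f \<Longrightarrow> deg_lt (fun_alg G) g d f' \<Longrightarrow> deg_lt (fun_alg G) g d (\<lambda>x. f x + f' x)"
proof (induction d arbitrary: f f')
  case (Suc d)
  then obtain a h a' h' where h: "a \<in> fun_alg G" "deg_lt (fun_alg G) g d h" "f = (\<lambda>x. a x * g x ^ d + h x)"
    "a' \<in> fun_alg G" "deg_lt (fun_alg G) g d h'" "f' = (\<lambda>x. a' x * g x ^ d + h' x)" by auto
  show ?case
    by (rule deg_lt_SucI[OF fun_alg.add[OF h(1,4)] Suc.IH[OF h(2,5)]]) (simp add: h(3,6) algebra_simps)
qed simp

lemma deg_lt_Suc: "deg_lt (fun_alg G) g d f \<Longrightarrow> deg_lt (fun_alg G) g (Suc d) f"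
  by (rule deg_lt_SucI[OF fun_alg.const[of 0]]) auto

lemma deg_lt_mono: "d \<le> d' \<Longrightarrow> deg_lt (fun_alg G) g d f \<Longrightarrow> deg_lt (fun_alg G) g d' f"
  by (induction d' rule: dec_induct) (auto simp del: deg_lt.simps intro: deg_lt_Suc)

lemma deg_lt_smult:
  "b \<in> fun_alg G \<Longrightarrow> deg_lt (fun_alg G) g d f \<Longrightarrow> deg_lt (fun_alg G) g d (\<lambda>x. b x * f x)"
proof (induction d arbitrary: f)
  case (Suc d)
  then obtain a h where h: "a \<in> fun_alg G" "deg_lt (fun_alg G) g d h" "f = (\<lambda>x. a x * g x ^ d + h x)" by auto
  show ?case
    by (rule deg_lt_SucI[OF fun_alg.mult[OF Suc.prems(1) h(1)] Suc.IH[OF Suc.prems(1) h(2)]])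
      (simp add: h(3) algebra_simps)
qed simp

lemma deg_lt_shift: "deg_lt (fun_alg G) g d f \<Longrightarrow> deg_lt (fun_alg G) g (d + k) (\<lambda>x. g x ^ k * f x)"
proof (induction d arbitrary: f)
  case 0
  have "deg_lt (fun_alg G) g k (\<lambda>_. 0)"
    using deg_lt_mono[of 0 k G g "\<lambda>_. 0"] by simp
  then show ?case using 0 by simp
next
  case (Suc d)
  then obtain a h where h: "a \<in> fun_alg G" "deg_lt (fun_alg G) g d h" "f = (\<lambda>x. a x * g x ^ d + h x)" by auto
  show ?case
    unfolding add_Suc by (rule deg_lt_SucI[OF h(1) Suc.IH[OF h(2)]]) (simp add: h(3) algebra_simps power_add)
qed

lemma deg_lt_mult:
  "deg_lt (fun_alg G) g d f \<Longrightarrow> deg_lt (fun_alg G) g d' f' \<Longrightarrow>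
    deg_lt (fun_alg G) g (d + d') (\<lambda>x. f x * f' x)"
proof (induction d arbitrary: f)
  case 0
  then show ?case using deg_lt_mono[of 0 d' G g "\<lambda>_. 0"] by simp
next
  case (Suc d)
  then obtain a h where h: "a \<in> fun_alg G" "deg_lt (fun_alg G) g d h" "f = (\<lambda>x. a x * g x ^ d + h x)" by auto
  have "deg_lt (fun_alg G) g (d' + d) (\<lambda>x. a x * (g x ^ d * f' x))"
    by (intro deg_lt_smult deg_lt_shift h Suc.prems)
  then have "deg_lt (fun_alg G) g (Suc d + d') (\<lambda>x. a x * (g x ^ d * f' x))"
    using deg_lt_mono[of "d' + d" "Suc d + d'"] by (simp del: deg_lt.simps)
  moreover have "deg_lt (fun_alg G) g (Suc d + d') (\<lambda>x. h x * f' x)"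
    using Suc.IH[OF h(2) Suc.prems(2)] deg_lt_Suc by (simp del: deg_lt.simps)
  ultimately have "deg_lt (fun_alg G) g (Suc d + d') (\<lambda>x. a x * (g x ^ d * f' x) + h x * f' x)"
    by (rule deg_lt_add)
  then show ?case by (simp add: h(3) algebra_simps del: deg_lt.simps)
qed

lemma fun_alg_mono: "G \<subseteq> G' \<Longrightarrow> fun_alg G \<subseteq> fun_alg G'"
proof
  fix f assume "G \<subseteq> G'" "f \<in> fun_alg G"
  from this(2,1) show "f \<in> fun_alg G'" by induction (auto intro: fun_alg.intros)
qed

lemma fun_alg_power: "f \<in> fun_alg G \<Longrightarrow> (\<lambda>x. f x ^ n) \<in> fun_alg G"
  by (induction n) (auto intro: fun_alg.const fun_alg.mult)

lemma deg_lt_insert: "f \<in> fun_alg (insert g G) \<Longrightarrow> \<exists>d. deg_lt (fun_alg G) g d f"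
proof (induction rule: fun_alg.induct)
  case (const c)
  have "deg_lt (fun_alg G) g (Suc 0) (\<lambda>_. c)"
    by (rule deg_lt_SucI[OF fun_alg.const[of c]]) auto
  then show ?case by blast
next
  case (gen f)
  show ?case
  proof (cases "f = g")
    case True
    have "deg_lt (fun_alg G) g (Suc 0) (\<lambda>_. 0)"
      by (rule deg_lt_SucI[OF fun_alg.const[of 0]]) auto
    then have "deg_lt (fun_alg G) g (Suc (Suc 0)) f"
      by (rule deg_lt_SucI[OF fun_alg.const[of 1]]) (auto simp: True)
    then show ?thesis by blast
  next
    case False
    with gen have "f \<in> fun_alg G" by (auto intro: fun_alg.gen)
    then have "deg_lt (fun_alg G) g (Suc 0) f" by (rule deg_lt_SucI) auto
    then show ?thesis by blast
  qed
next
  case (add f f')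
  then obtain d d' where "deg_lt (fun_alg G) g d f" "deg_lt (fun_alg G) g d' f'" by blast
  then have "deg_lt (fun_alg G) g (max d d') f" "deg_lt (fun_alg G) g (max d d') f'"
    using deg_lt_mono by (meson max.cobounded1, meson max.cobounded2)
  then show ?case using deg_lt_add by blast
next
  case (mult f f')
  then show ?case using deg_lt_mult by blast
qed

text \<open>Hilbert's argument: successively pick \<open>h n\<close> of least degree in the ideal
  outside the ideal of its predecessors. Some leading coefficient \<open>a N\<close> is a
  combination of earlier ones, and the matching combination of the earlier \<open>h i\<close>
  cancels the leading term of \<open>h N\<close>, contradicting minimality.\<close>

lemma noetherian_insert:
  assumes R: "noetherian (fun_alg G)"
  shows "noetherian (fun_alg (insert g G))"
  unfolding noetherian_def
proof (intro allI impI, rule ccontr)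
  let ?R = "fun_alg G" and ?R' = "fun_alg (insert g G)"
  have RR': "?R \<subseteq> ?R'" by (intro fun_alg_mono) auto
  fix f assume f: "\<forall>n :: nat. f n \<in> ?R'" and "\<nexists>n. f n \<in> ideal_of ?R' (f ` {..<n})"
  then have bad: "f n \<notin> ideal_of ?R' (f ` {..<n})" for n by blast
  let ?I = "ideal_of ?R' (range f)"
  have IR': "h \<in> ?R'" if "h \<in> ?I" for h
    using that by induction (use f in \<open>auto intro!: fun_alg.const fun_alg.add fun_alg.mult\<close>)
  have I_stage: "\<exists>N. h \<in> ideal_of ?R' (f ` {..<N})" if "h \<in> ?I" for h
    using that
  proof induction
    case (step a s i)
    then obtain N n where N: "i \<in> ideal_of ?R' (f ` {..<N})" "s = f n" by auto
    then have "i \<in> ideal_of ?R' (f ` {..<max N (Suc n)})"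
      using ideal_of_mono[of "f ` {..<N}" "f ` {..<max N (Suc n)}" "insert g G"] by force
    moreover have "s \<in> f ` {..<max N (Suc n)}" using N by auto
    ultimately have "(\<lambda>x. a x * s x + i x) \<in> ideal_of ?R' (f ` {..<max N (Suc n)})"
      by (intro ideal_of.step step(1))
    then show ?case by (rule exI)
  qed (auto intro: ideal_of.zero)
  \<comment> \<open>Finitely many elements of \<open>?I\<close> lie in the ideal of an initial
    segment of \<open>f\<close>, and the next member of the sequence escapes that ideal.\<close>
  have new: "\<exists>h\<in>?I. h \<notin> ideal_of ?R' F" if F: "finite F" "F \<subseteq> ?I" for F
  proof -
    obtain N where N: "\<And>h. h \<in> F \<Longrightarrow> h \<in> ideal_of ?R' (f ` {..<N h})"
      using I_stage F(2) by (metis subsetD)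
    have "F \<subseteq> ideal_of ?R' (f ` {..<Max (N ` F)})"
    proof
      fix h assume h: "h \<in> F"
      then have "f ` {..<N h} \<subseteq> f ` {..<Max (N ` F)}" using F(1) by (auto intro!: imageI less_le_trans[OF _ Max_ge])
      with N[OF h] ideal_of_mono show "h \<in> ideal_of ?R' (f ` {..<Max (N ` F)})" by blast
    qed
    then have "f (Max (N ` F)) \<notin> ideal_of ?R' F" using ideal_of_least bad by blast
    then show ?thesis using ideal_of_inc[of _ "range f"] by blast
  qed
  define P where "P h n r \<longleftrightarrow> fst r \<in> ?I \<and> fst r \<notin> ideal_of ?R' ((fst \<circ> h) ` {..<n}) \<and>
      deg_lt ?R g (snd r) (fst r) \<and>
      (\<forall>s d. s \<in> ?I \<longrightarrow> s \<notin> ideal_of ?R' ((fst \<circ> h) ` {..<n}) \<longrightarrow> deg_lt ?R g d s \<longrightarrow> snd r \<le> d)"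
    for h :: "nat \<Rightarrow> ('a \<Rightarrow> complex) \<times> nat" and n :: nat and r :: "('a \<Rightarrow> complex) \<times> nat"
  have "\<exists>h. \<forall>n. P h n (h n)"
  proof (rule dependent_wellorder_choice)
    show "P h n r = P h' n r" if "\<And>m. m < n \<Longrightarrow> h m = h' m" for r h h' n
    proof -
      have "(fst \<circ> h) ` {..<n} = (fst \<circ> h') ` {..<n}" using that by (intro image_cong) auto
      then show ?thesis by (simp add: P_def)
    qed
    show "\<exists>r. P h n r" if "\<And>m. m < n \<Longrightarrow> P h m (h m)" for h n
    proof -
      define J where "J = ideal_of ?R' ((fst \<circ> h) ` {..<n})"
      have "\<exists>s\<in>?I. s \<notin> J"
        unfolding J_def by (rule new) (use that in \<open>auto simp: P_def\<close>)
      then obtain s where "s \<in> ?I" "s \<notin> J" by blast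
      moreover from this(1) obtain d where "deg_lt ?R g d s" using deg_lt_insert IR' by blast
      ultimately have ex: "\<exists>d s. s \<in> ?I \<and> s \<notin> J \<and> deg_lt ?R g d s" by blast
      define d where "d = (LEAST d. \<exists>s. s \<in> ?I \<and> s \<notin> J \<and> deg_lt ?R g d s)"
      from LeastI_ex[OF ex] obtain s where s: "s \<in> ?I" "s \<notin> J" "deg_lt ?R g d s"
        unfolding d_def by blast
      have "d \<le> d'" if "s' \<in> ?I" "s' \<notin> J" "deg_lt ?R g d' s'" for d' s'
        unfolding d_def by (rule Least_le) (use that in blast)
      with s have "P h n (s, d)" unfolding P_def J_def[symmetric] by simp
      then show ?thesis by blast
    qed
  qed
  then obtain hd where hd: "\<And>n. P hd n (hd n)" by blast
  define h where "h n = fst (hd n)" for n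
  define d where "d n = snd (hd n)" for n
  have fst_hd: "fst \<circ> hd = h" by (auto simp: h_def)
  have h: "h n \<in> ?I" "h n \<notin> ideal_of ?R' (h ` {..<n})" "deg_lt ?R g (d n) (h n)"
    and d_min: "\<And>s d'. s \<in> ?I \<Longrightarrow> s \<notin> ideal_of ?R' (h ` {..<n}) \<Longrightarrow> deg_lt ?R g d' s \<Longrightarrow> d n \<le> d'" for n
    using hd[of n] unfolding P_def fst_hd h_def[symmetric] d_def[symmetric] by blast+
  have "\<exists>a l k. a \<in> ?R \<and> deg_lt ?R g k l \<and> d n = Suc k \<and> h n = (\<lambda>x. a x * g x ^ k + l x)" for n
  proof (cases "d n")
    case 0
    then show ?thesis using h[of n] ideal_of.zero by auto
  next
    case (Suc k)
    then show ?thesis using h(3)[of n] by auto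
  qed
  then have "\<forall>n. \<exists>a l k. a \<in> ?R \<and> deg_lt ?R g k l \<and> d n = Suc k \<and> h n = (\<lambda>x. a x * g x ^ k + l x)" ..
  then obtain a l k where alk: "\<And>n. a n \<in> ?R" "\<And>n. deg_lt ?R g (k n) (l n)"
    "\<And>n. d n = Suc (k n)" "\<And>n. h n = (\<lambda>x. a n x * g x ^ k n + l n x)"
    unfolding choice_iff by blast
  obtain N where N: "a N \<in> ideal_of ?R (a ` {..<N})" using R alk(1) unfolding noetherian_def by blast
  \<comment> \<open>\<open>h N\<close> was already a candidate at stage \<open>i\<close>, so its
    degree is at least the one chosen there. This makes the exponents \<open>k N - k i\<close> below
    genuine differences.\<close>
  have d_mono: "k i \<le> k N" if "i < N" for i
  proof -
    have "h ` {..<i} \<subseteq> h ` {..<N}" using that by auto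
    then have "h N \<notin> ideal_of ?R' (h ` {..<i})" using h(2)[of N] ideal_of_mono by blast
    then show ?thesis using d_min[OF h(1)[of N] _ h(3)[of N]] alk(3) by force
  qed
  have "\<exists>q m. q \<in> ideal_of ?R' (h ` {..<N}) \<and> deg_lt ?R g (k N) m \<and> q = (\<lambda>x. b x * g x ^ k N + m x)"
    if "b \<in> ideal_of ?R (a ` {..<N})" for b
    using that
  proof induction
    case zero
    have "deg_lt ?R g (k N) (\<lambda>_. 0)" using deg_lt_mono[of 0 "k N" G g "\<lambda>_. 0"] by simp
    then show ?case using ideal_of.zero by (intro exI[of _ "\<lambda>_. 0"]) auto
  next
    case (step c s b)
    then obtain i q m where i: "i < N" "s = a i" and q: "q \<in> ideal_of ?R' (h ` {..<N})"
      "deg_lt ?R g (k N) m" "q = (\<lambda>x. b x * g x ^ k N + m x)" by auto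
    let ?j = "k N - k i"
    have j: "k i + ?j = k N" using d_mono[OF i(1)] by simp
    have "(\<lambda>x. (c x * g x ^ ?j) * h i x + q x) \<in> ideal_of ?R' (h ` {..<N})"
      using i(1) q(1)
      by (intro ideal_of.step fun_alg.mult[OF subsetD[OF RR' step(1)]] fun_alg_power fun_alg.gen) auto
    moreover have "deg_lt ?R g (k N) (\<lambda>x. c x * (g x ^ ?j * l i x) + m x)"
      using deg_lt_shift[OF alk(2)[of i], of ?j] unfolding j
      by (rule deg_lt_add[OF deg_lt_smult[OF step(1)] q(2)])
    moreover have "(c x * g x ^ ?j) * h i x + q x =
        (c x * s x + b x) * g x ^ k N + (c x * (g x ^ ?j * l i x) + m x)" for x
    proof -
      have "g x ^ k N = g x ^ k i * g x ^ ?j" by (simp only: j power_add[symmetric])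
      then show ?thesis unfolding alk(4)[of i] q(3) i(2) by (simp add: algebra_simps)
    qed
    ultimately show ?case
      by (intro exI[of _ "\<lambda>x. (c x * g x ^ ?j) * h i x + q x"]
          exI[of _ "\<lambda>x. c x * (g x ^ ?j * l i x) + m x"]) simp
  qed
  from this[OF N] obtain q m where q: "q \<in> ideal_of ?R' (h ` {..<N})" "deg_lt ?R g (k N) m"
    "q = (\<lambda>x. a N x * g x ^ k N + m x)" by blast
  \<comment> \<open>The difference has lower degree than \<open>h N\<close> but still avoids the
    ideal of the predecessors, since otherwise \<open>h N\<close> would belong to it.\<close>
  let ?s = "\<lambda>x. h N x + -1 * q x"
  have q': "(\<lambda>x. - 1 * q x) \<in> ideal_of ?R' (h ` {..<N})"
    by (intro ideal_of_mult fun_alg.const q(1))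
  have "?s = (\<lambda>x. l N x + -1 * m x)" by (simp add: alk(4)[of N] q(3))
  then have "deg_lt ?R g (k N) ?s"
    using deg_lt_add[OF alk(2)[of N] deg_lt_smult[OF fun_alg.const[of "-1"] q(2)]] by simp
  moreover have "?s \<in> ?I"
  proof -
    have "ideal_of ?R' (h ` {..<N}) \<subseteq> ?I" using h(1) by (intro ideal_of_least) auto
    then show ?thesis using h(1) q' by (intro ideal_of_add) auto
  qed
  moreover have "?s \<notin> ideal_of ?R' (h ` {..<N})"
  proof
    assume "?s \<in> ideal_of ?R' (h ` {..<N})"
    from ideal_of_add[OF this q(1)] show False using h(2)[of N] by simp
  qed
  ultimately show False using d_min[of ?s N "k N"] alk(3)[of N] by simp
qed

lemma noetherian_fun_alg: "finite G \<Longrightarrow> noetherian (fun_alg G)"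
  by (induction rule: finite_induct) (auto intro: noetherian_constants noetherian_insert)

section \<open>Definable subgroups of GL2\<close>

lemma GL2_iff: "A \<in> GL2 \<longleftrightarrow> det A \<noteq> 0"
  by (simp add: GL2_def invertible_det_nz)

lemma GL2_mult_iff: "A ** B \<in> GL2 \<longleftrightarrow> A \<in> GL2 \<and> B \<in> GL2"
  by (simp add: GL2_iff det_mul)

text \<open>The adjugate divided by the determinant, written out so that its entries visibly lie in
  the coordinate ring; on singular matrices it is 0.\<close>

definition minv :: "mat2 \<Rightarrow> mat2" where
  "minv A = (\<chi> i j. inverse (det A) *
     (if i = 1 then if j = 1 then A $ 2 $ 2 else - A $ 1 $ 2 else if j = 1 then - A $ 2 $ 1 else A $ 1 $ 1))"

lemma minv_right: assumes "A \<in> GL2" shows "A ** minv A = mat 1"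
proof -
  define c where "c = inverse (det A)"
  have "c * (A $ 1 $ 1 * A $ 2 $ 2 - A $ 1 $ 2 * A $ 2 $ 1) = 1"
    using assms by (simp add: c_def GL2_iff flip: det_2)
  then show ?thesis
    by (simp add: minv_def c_def[symmetric] vec_eq_iff forall_2 matrix_matrix_mult_def sum_2 mat_def algebra_simps)
qed

lemma minv_left: "A \<in> GL2 \<Longrightarrow> minv A ** A = mat 1"
  using minv_right matrix_left_right_inverse by blast

lemma minv_GL2: "A \<in> GL2 \<Longrightarrow> minv A \<in> GL2"
  using minv_right[of A] GL2_mult_iff[of A "minv A"] by (simp add: GL2_iff)

lemma minv_cancel_left: "A \<in> GL2 \<Longrightarrow> minv A ** (A ** B) = B"
  by (simp add: matrix_mul_assoc minv_left)

lemma minv_cancel_right: "A \<in> GL2 \<Longrightarrow> A ** (minv A ** B) = B"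
  by (simp add: matrix_mul_assoc minv_right)

lemma minv_unique: "A \<in> GL2 \<Longrightarrow> A ** B = mat 1 \<Longrightarrow> B = minv A"
  by (metis minv_cancel_left matrix_mul_rid)

lemma minv_minv: "A \<in> GL2 \<Longrightarrow> minv (minv A) = A"
  using minv_unique[OF minv_GL2 minv_left] by simp

lemma minv_mult: "A \<in> GL2 \<Longrightarrow> B \<in> GL2 \<Longrightarrow> minv (A ** B) = minv B ** minv A"
  by (rule minv_unique[symmetric])
    (simp_all add: GL2_mult_iff minv_cancel_right minv_right flip: matrix_mul_assoc)

text \<open>The coordinate ring of \<open>GL2\<close>, as total functions; \<open>inverse (det A)\<close> is zero for singular \<open>A\<close>.\<close>

definition GL2_gens :: "(mat2 \<Rightarrow> complex) set" where
  "GL2_gens = insert (\<lambda>A. inverse (det A)) (range (\<lambda>(i, j) A. A $ i $ j))"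

abbreviation GL2_ring :: "(mat2 \<Rightarrow> complex) set" where
  "GL2_ring \<equiv> fun_alg GL2_gens"

lemma noetherian_GL2_ring: "noetherian GL2_ring"
  by (rule noetherian_fun_alg) (simp add: GL2_gens_def)

lemma GL2_ring_entry: "(\<lambda>A. A $ i $ j) \<in> GL2_ring"
  by (rule fun_alg.gen) (force simp: GL2_gens_def)

lemma GL2_ring_inverse_det: "(\<lambda>A. inverse (det A)) \<in> GL2_ring"
  by (rule fun_alg.gen) (simp add: GL2_gens_def)

lemma GL2_ring_compose:
  assumes "f \<in> GL2_ring" "\<And>i j. (\<lambda>A. s A $ i $ j) \<in> GL2_ring" "(\<lambda>A. inverse (det (s A))) \<in> GL2_ring"
  shows "(\<lambda>A. f (s A)) \<in> GL2_ring"
  by (rule fun_alg_compose[OF assms(1)]) (use assms(2,3) in \<open>auto simp: GL2_gens_def\<close>)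

lemma GL2_ring_mult_left: "f \<in> GL2_ring \<Longrightarrow> (\<lambda>A. f (B ** A)) \<in> GL2_ring"
proof (rule GL2_ring_compose)
  show "(\<lambda>A. (B ** A) $ i $ j) \<in> GL2_ring" for i j
    unfolding matrix_matrix_mult_def vec_lambda_beta
    by (intro fun_alg_sum fun_alg.mult fun_alg.const GL2_ring_entry)
  show "(\<lambda>A. inverse (det (B ** A))) \<in> GL2_ring"
    unfolding det_mul inverse_mult_distrib
    by (intro fun_alg.mult fun_alg.const GL2_ring_inverse_det)
qed

lemma GL2_ring_mult_right: "f \<in> GL2_ring \<Longrightarrow> (\<lambda>A. f (A ** B)) \<in> GL2_ring"
proof (rule GL2_ring_compose)
  show "(\<lambda>A. (A ** B) $ i $ j) \<in> GL2_ring" for i j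
    unfolding matrix_matrix_mult_def vec_lambda_beta
    by (intro fun_alg_sum fun_alg.mult fun_alg.const GL2_ring_entry)
  show "(\<lambda>A. inverse (det (A ** B))) \<in> GL2_ring"
    unfolding det_mul inverse_mult_distrib
    by (intro fun_alg.mult fun_alg.const GL2_ring_inverse_det)
qed

lemma GL2_ring_minv: "f \<in> GL2_ring \<Longrightarrow> (\<lambda>A. f (minv A)) \<in> GL2_ring"
proof (rule GL2_ring_compose)
  show "(\<lambda>A. minv A $ i $ j) \<in> GL2_ring" for i j
    unfolding minv_def vec_lambda_beta
    by (cases "i = 1"; cases "j = 1")
      (simp_all add: fun_alg.mult GL2_ring_inverse_det fun_alg_uminus GL2_ring_entry)
  \<comment> \<open>The identity has to hold for all matrices, as the ring consists of total
    functions; for singular \<open>A\<close> both sides are 0.\<close>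
  have "inverse (det (minv A)) = det A" for A
  proof (cases "det A = 0")
    case True
    then show ?thesis by (simp add: minv_def det_2)
  next
    case False
    then have "det A * det (minv A) = 1"
      using minv_right[of A] det_mul[of A "minv A"] by (simp add: GL2_iff)
    then show ?thesis using False by (metis inverse_unique mult.commute)
  qed
  then show "(\<lambda>A. inverse (det (minv A))) \<in> GL2_ring"
    unfolding det_2 by (simp add: fun_alg_diff fun_alg.mult GL2_ring_entry)
qed

lemma mterm_det: "mterm t \<Longrightarrow> (\<lambda>e. det (t e)) \<in> poly_funs"
  unfolding mterm_def det_2 by (intro fun_alg_diff fun_alg.mult) auto

lemma constructible_GL2: "mterm t \<Longrightarrow> constructible (\<lambda>e. t e \<in> GL2)"
  unfolding GL2_iff by (intro constructible.neg constructible.eq0 mterm_det)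

text \<open>\<open>GL2\<close> embedded in affine 5-space, with the inverse determinant as fifth
  coordinate. Along this map elements of \<open>GL2_ring\<close> are restrictions of polynomial
  functions, so statements about \<open>constructible\<close> apply to them.\<close>

definition mat_env :: "mat2 \<Rightarrow> nat \<Rightarrow> complex" where
  "mat_env A n = (if n = 0 then A $ 1 $ 1 else if n = 1 then A $ 1 $ 2 else if n = 2 then A $ 2 $ 1
     else if n = 3 then A $ 2 $ 2 else if n = 4 then inverse (det A) else 0)"

lemma mat_of_mat_env: "mat_of 0 (mat_env A) = A"
  by (simp add: mat_of_def mat_env_def vec_eq_iff forall_2)

lemma mat_env_GL2_ring: "(\<lambda>A. mat_env A n) \<in> GL2_ring"
  unfolding mat_env_def
  by (cases "n = 0"; cases "n = 1"; cases "n = 2"; cases "n = 3"; cases "n = 4")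
    (simp_all add: GL2_ring_entry GL2_ring_inverse_det fun_alg.const)

lemma GL2_ring_as_poly_funs:
  assumes "f \<in> GL2_ring" shows "\<exists>p\<in>poly_funs. \<forall>A. f A = p (mat_env A)"
  using assms
proof induction
  case (const c)
  show ?case by (rule bexI[OF _ fun_alg.const[of c]]) simp
next
  case (gen g)
  then consider "g = (\<lambda>A. inverse (det A))" | i j where "g = (\<lambda>A. A $ i $ j)"
    by (auto simp: GL2_gens_def)
  then show ?case
  proof cases
    case 1
    then show ?thesis by (intro bexI[OF _ poly_funs_var[of 4]]) (simp add: mat_env_def)
  next
    case 2
    define n :: nat where "n = (if i = 1 then if j = 1 then 0 else 1 else if j = 1 then 2 else 3)"
    have "g A = mat_env A n" for A
      using 2 exhaust_2[of i] exhaust_2[of j] by (auto simp: mat_env_def n_def)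
    then show ?thesis by (intro bexI[OF _ poly_funs_var[of n]]) simp
  qed
next
  case (add f g)
  then obtain p q where "p \<in> poly_funs" "q \<in> poly_funs" "\<forall>A. f A = p (mat_env A)" "\<forall>A. g A = q (mat_env A)" by blast
  then show ?case by (intro bexI[OF _ fun_alg.add[of p _ q]]) simp_all
next
  case (mult f g)
  then obtain p q where "p \<in> poly_funs" "q \<in> poly_funs" "\<forall>A. f A = p (mat_env A)" "\<forall>A. g A = q (mat_env A)" by blast
  then show ?case by (intro bexI[OF _ fun_alg.mult[of p _ q]]) simp_all
qed

lemma defm_GL2_ring_zeros:
  assumes "f \<in> GL2_ring" shows "defm {A \<in> GL2. f A = 0}"
proof -
  obtain p where p: "p \<in> poly_funs" "\<And>A. f A = p (mat_env A)" using GL2_ring_as_poly_funs[OF assms] by blast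
  \<comment> \<open>\<open>p\<close> may involve coordinates above 4; these are set to 0 here, as
    they are in \<open>mat_env\<close>. Coordinate 4 is quantified and forced to be the inverse
    determinant.\<close>
  define s :: "(nat \<Rightarrow> complex) \<Rightarrow> nat \<Rightarrow> complex" where "s e n = (if n \<le> 4 then e n else 0)" for e n
  have s: "(\<lambda>e. s e n) \<in> poly_funs" for n
    by (cases "n \<le> 4") (simp_all add: s_def poly_funs_var fun_alg.const)
  have "constructible (\<lambda>e. \<exists>z. det (mat_of 0 (e(4 := z))) * (e(4 := z)) 4 = 1 \<and> p (s (e(4 := z))) = 0)"
    by (intro constructible_ex constructible.conj constructible_eq fun_alg.mult mterm_det mterm_mat_of poly_funs_var fun_alg.const
        poly_funs_compose[OF p(1)] constructible.eq0 s)
  moreover have "(\<exists>z. det (mat_of 0 (e(4 := z))) * (e(4 := z)) 4 = 1 \<and> p (s (e(4 := z))) = 0) \<longleftrightarrow>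
      mat_of 0 e \<in> {A \<in> GL2. f A = 0}" for e
  proof -
    have m: "mat_of 0 (e(4 := z)) = mat_of 0 e" for z by (simp add: mat_of_def vec_eq_iff)
    have "s (e(4 := z)) = mat_env (mat_of 0 e)" if "z = inverse (det (mat_of 0 e))" for z
    proof
      fix n :: nat
      have "n = 0 \<or> n = 1 \<or> n = 2 \<or> n = 3 \<or> n = 4 \<or> 4 < n" by linarith
      then show "s (e(4 := z)) n = mat_env (mat_of 0 e) n"
        using that by (elim disjE) (simp_all add: s_def mat_env_def mat_of_def numeral_2_eq_2 numeral_3_eq_3)
    qed
    moreover have "det (mat_of 0 e) * z = 1 \<longleftrightarrow> det (mat_of 0 e) \<noteq> 0 \<and> z = inverse (det (mat_of 0 e))" for z
      by (metis inverse_unique mult_eq_0_iff right_inverse zero_neq_one)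
    ultimately show ?thesis unfolding m by (auto simp: GL2_iff p(2))
  qed
  ultimately show ?thesis unfolding defm_def by (simp only:)
qed

text \<open>The boundary of a constructible set is nowhere dense: every nonempty basic open subset of \<open>Y\<close>
  contains one on which \<open>Q\<close> is constant.\<close>

lemma constructible_decided_on_open:
  assumes "constructible Q" "f \<in> GL2_ring" "y \<in> Y" "f y \<noteq> 0"
  shows "\<exists>g\<in>GL2_ring. (\<exists>y\<in>Y. g y \<noteq> 0) \<and> (\<forall>y\<in>Y. g y \<noteq> 0 \<longrightarrow> f y \<noteq> 0) \<and>
    ((\<forall>y\<in>Y. g y \<noteq> 0 \<longrightarrow> Q (mat_env y)) \<or> (\<forall>y\<in>Y. g y \<noteq> 0 \<longrightarrow> \<not> Q (mat_env y)))"
  using assms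
proof (induction arbitrary: f y)
  case (eq0 p)
  have p: "(\<lambda>A. p (mat_env A)) \<in> GL2_ring"
    by (rule poly_funs_compose[OF eq0(1) mat_env_GL2_ring])
  show ?case
  proof (cases "\<exists>y\<in>Y. f y * p (mat_env y) \<noteq> 0")
    case True
    then show ?thesis by (intro bexI[OF _ fun_alg.mult[OF eq0(2) p]]) auto
  next
    case False
    then show ?thesis using eq0 by (intro bexI[of _ f]) auto
  qed
next
  case (neg Q)
  from neg.IH[OF neg.prems] show ?case by blast
next
  case (conj Q R)
  from conj.IH(1)[OF conj.prems] obtain g y' where g: "g \<in> GL2_ring" "y' \<in> Y" "g y' \<noteq> 0"
    "\<forall>y\<in>Y. g y \<noteq> 0 \<longrightarrow> f y \<noteq> 0"
    "(\<forall>y\<in>Y. g y \<noteq> 0 \<longrightarrow> Q (mat_env y)) \<or> (\<forall>y\<in>Y. g y \<noteq> 0 \<longrightarrow> \<not> Q (mat_env y))" by blast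
  from conj.IH(2)[OF g(1-3)] obtain k where k: "k \<in> GL2_ring" "\<exists>y\<in>Y. k y \<noteq> 0"
    "\<forall>y\<in>Y. k y \<noteq> 0 \<longrightarrow> g y \<noteq> 0"
    "(\<forall>y\<in>Y. k y \<noteq> 0 \<longrightarrow> R (mat_env y)) \<or> (\<forall>y\<in>Y. k y \<noteq> 0 \<longrightarrow> \<not> R (mat_env y))" by blast
  show ?case using g k by (intro bexI[OF _ k(1)]) blast
qed

lemma funpow_cancel:
  assumes "\<And>x. g (f x) = x" shows "(g ^^ m) ((f ^^ (m + k)) x) = (f ^^ k) x"
proof (induction m)
  case (Suc m)
  have "(g ^^ Suc m) y = (g ^^ m) (g y)" for y by (simp add: funpow_swap1)
  then show ?case using Suc by (simp add: assms)
qed simp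

section \<open>Zariski closures of multiplicative subsets of GL2\<close>

definition zclosure :: "mat2 set \<Rightarrow> mat2 set" where
  "zclosure X = {y \<in> GL2. \<forall>f\<in>GL2_ring. (\<forall>x\<in>X. f x = 0) \<longrightarrow> f y = 0}"

lemma defm_zclosure: "defm (zclosure X)"
proof -
  let ?S = "{f \<in> GL2_ring. \<forall>x\<in>X. f x = 0}"
  obtain F where F: "finite F" "F \<subseteq> ?S" "?S \<subseteq> ideal_of GL2_ring F"
    using noetherian_finite_basis[OF noetherian_GL2_ring, of ?S] by blast
  \<comment> \<open>The zero function keeps the intersection inside \<open>GL2\<close> when the
    finite basis \<open>F\<close> is empty.\<close>
  have "zclosure X = (\<Inter>f\<in>insert (\<lambda>_. 0) F. {y \<in> GL2. f y = 0})"
  proof safe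
    fix y f assume "y \<in> zclosure X" "f \<in> F"
    then show "f y = 0" using F(2) by (auto simp: zclosure_def)
  next
    fix y assume y: "y \<in> (\<Inter>f\<in>insert (\<lambda>_. 0) F. {y \<in> GL2. f y = 0})"
    show "y \<in> zclosure X"
      unfolding zclosure_def
    proof (intro CollectI conjI ballI impI)
      show "y \<in> GL2" using y by auto
      fix f assume "f \<in> GL2_ring" "\<forall>x\<in>X. f x = 0"
      then have "f \<in> ideal_of GL2_ring F" using F(3) by blast
      then show "f y = 0" by (rule ideal_of_zeros) (use y in auto)
    qed
  qed (auto simp: zclosure_def)
  moreover have "defm (\<Inter>f\<in>insert (\<lambda>_. 0) F. {y \<in> GL2. f y = 0})"
  proof (rule defm_Inter)
    fix Z assume "Z \<in> (\<lambda>f. {y \<in> GL2. f y = 0}) ` insert (\<lambda>_. 0) F"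
    then obtain f where Z: "Z = {y \<in> GL2. f y = 0}" and "f \<in> insert (\<lambda>_. 0) F" by (elim imageE)
    then have "f \<in> GL2_ring" using F(2) fun_alg.const[of 0] by blast
    then show "defm Z" unfolding Z by (rule defm_GL2_ring_zeros)
  qed (use F(1) in simp)
  ultimately show ?thesis by simp
qed

context
  fixes X :: "mat2 set"
  assumes X_GL2: "X \<subseteq> GL2" and X_mult: "\<And>x y. x \<in> X \<Longrightarrow> y \<in> X \<Longrightarrow> x ** y \<in> X"
begin

lemma zclosure_GL2: "y \<in> zclosure X \<Longrightarrow> y \<in> GL2"
  by (simp add: zclosure_def)

lemma zclosure_inc: "x \<in> X \<Longrightarrow> x \<in> zclosure X"
  using X_GL2 by (auto simp: zclosure_def)

lemma zclosure_zero: "y \<in> zclosure X \<Longrightarrow> f \<in> GL2_ring \<Longrightarrow> (\<And>x. x \<in> X \<Longrightarrow> f x = 0) \<Longrightarrow> f y = 0"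
  by (simp add: zclosure_def)

text \<open>One factor at a time: translation by a fixed element preserves \<open>GL2_ring\<close>,
  so a function vanishing on products from \<open>X\<close> first vanishes on \<open>x ** z\<close>
  with \<open>z\<close> in the closure, and then on \<open>y ** z\<close>.\<close>

lemma zclosure_mult:
  assumes y: "y \<in> zclosure X" "z \<in> zclosure X" shows "y ** z \<in> zclosure X"
  unfolding zclosure_def
proof (intro CollectI conjI ballI impI)
  show "y ** z \<in> GL2" using y by (simp add: GL2_mult_iff zclosure_GL2)
  fix f assume f: "f \<in> GL2_ring" "\<forall>x\<in>X. f x = 0"
  have "f (x ** z) = 0" if "x \<in> X" for x
    by (rule zclosure_zero[OF y(2) GL2_ring_mult_left[OF f(1)]]) (use that f(2) X_mult in auto)
  then show "f (y ** z) = 0"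
    by (rule zclosure_zero[OF y(1) GL2_ring_mult_right[OF f(1)]])
qed

text \<open>Suppose \<open>f\<close> vanishes on \<open>X\<close> but not at
  \<open>minv a ** y\<close>. Let \<open>g n\<close> be \<open>f\<close> after n + 1 divisions by
  \<open>a\<close>. Some \<open>g N\<close> is a combination of its predecessors. At the point
  obtained from \<open>y\<close> by N multiplications by \<open>a\<close>, the predecessors take
  values of \<open>f\<close> on the closure, which are 0, whereas \<open>g N\<close> takes the value
  of \<open>f\<close> at \<open>minv a ** y\<close>.\<close>

lemma zclosure_minv_mult:
  assumes a: "a \<in> zclosure X" and y: "y \<in> zclosure X" shows "minv a ** y \<in> zclosure X"
proof (rule ccontr)
  have aG: "a \<in> GL2" using a zclosure_GL2 by blast
  assume "minv a ** y \<notin> zclosure X"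
  moreover have "minv a ** y \<in> GL2" using aG y by (simp add: GL2_mult_iff minv_GL2 zclosure_GL2)
  ultimately obtain f where f: "f \<in> GL2_ring" "\<And>x. x \<in> X \<Longrightarrow> f x = 0" "f (minv a ** y) \<noteq> 0"
    by (auto simp: zclosure_def)
  define g where "g n z = f (((**) (minv a) ^^ Suc n) z)" for n z
  have "(\<lambda>z. f (((**) (minv a) ^^ n) z)) \<in> GL2_ring" for n
  proof (induction n)
    case (Suc n)
    from GL2_ring_mult_left[OF this, of "minv a"] show ?case by (simp add: funpow_swap1)
  qed (use f in simp)
  then have "g n \<in> GL2_ring" for n unfolding g_def by blast
  then obtain N where N: "g N \<in> ideal_of GL2_ring (g ` {..<N})"
    using noetherian_GL2_ring unfolding noetherian_def by blast
  have cancel: "((**) (minv a) ^^ m) (((**) a ^^ (m + k)) z) = ((**) a ^^ k) z" for m k z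
    by (rule funpow_cancel) (rule minv_cancel_left[OF aG])
  have "g N (((**) a ^^ N) y) = 0"
  proof (rule ideal_of_zeros[OF N])
    fix s assume "s \<in> g ` {..<N}"
    then obtain i where i: "i < N" "s = g i" by auto
    then have "s (((**) a ^^ N) y) = f (((**) a ^^ (N - Suc i)) y)"
      using cancel[of "Suc i" "N - Suc i" y] by (simp add: g_def del: funpow.simps)
    moreover have "((**) a ^^ m) y \<in> zclosure X" for m
      by (induction m) (use y a zclosure_mult in auto)
    then have "f (((**) a ^^ (N - Suc i)) y) = 0" using f zclosure_zero by blast
    ultimately show "s (((**) a ^^ N) y) = 0" by simp
  qed
  moreover have "g N (((**) a ^^ N) y) = f (minv a ** y)"
    using cancel[of N 0 y] by (simp add: g_def)
  ultimately show False using f(3) by simp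
qed

text \<open>A nonempty open subset of the closure meets \<open>X\<close>, hence \<open>D\<close>; so
  where membership in \<open>D\<close> is constant on such a subset, it holds there.\<close>

lemma zclosure_decided:
  assumes D: "defm D" "X \<subseteq> D" and f: "f \<in> GL2_ring" "y \<in> zclosure X" "f y \<noteq> 0"
  obtains g z where "g \<in> GL2_ring" "z \<in> zclosure X" "g z \<noteq> 0"
    "\<And>y. y \<in> zclosure X \<Longrightarrow> g y \<noteq> 0 \<Longrightarrow> f y \<noteq> 0 \<and> y \<in> D"
proof -
  obtain g z where g: "g \<in> GL2_ring" "z \<in> zclosure X" "g z \<noteq> 0" "\<forall>y\<in>zclosure X. g y \<noteq> 0 \<longrightarrow> f y \<noteq> 0"
    and dec: "(\<forall>y\<in>zclosure X. g y \<noteq> 0 \<longrightarrow> y \<in> D) \<or> (\<forall>y\<in>zclosure X. g y \<noteq> 0 \<longrightarrow> y \<notin> D)"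
    using constructible_decided_on_open[OF D(1)[unfolded defm_def] f] unfolding mat_of_mat_env by blast
  have "\<exists>x\<in>X. g x \<noteq> 0" using zclosure_zero[OF g(2,1)] g(3) by blast
  then have "\<forall>y\<in>zclosure X. g y \<noteq> 0 \<longrightarrow> y \<in> D" using dec D(2) zclosure_inc by blast
  then show ?thesis using that g by blast
qed

text \<open>The closure may be reducible, so two nonempty open subsets need not meet. Therefore a
  single open set where \<open>g\<close> is nonzero is fixed inside \<open>D\<close>, and density of
  \<open>D\<close> then gives a point \<open>y\<close> of \<open>D\<close> for which
  \<open>h ** minv y\<close> falls into that set.\<close>

lemma zclosure_product_of_definable:
  assumes D: "defm D" "X \<subseteq> D" and h: "h \<in> zclosure X"
  shows "\<exists>A B. A \<in> GL2 \<and> A \<in> D \<and> B \<in> D \<and> B ** A = h"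
proof -
  have 1: "mat 1 \<in> zclosure X"
    using zclosure_minv_mult[OF h h] h by (simp add: minv_left zclosure_GL2)
  have hG: "h \<in> GL2" using h zclosure_GL2 by blast
  obtain g z where g: "g \<in> GL2_ring" "z \<in> zclosure X" "g z \<noteq> 0"
    "\<And>y. y \<in> zclosure X \<Longrightarrow> g y \<noteq> 0 \<Longrightarrow> y \<in> D"
    using zclosure_decided[OF D fun_alg.const[of 1] h] by auto
  have zG: "z \<in> GL2" using g zclosure_GL2 by blast
  let ?f = "\<lambda>y. g (h ** minv y)"
  have f: "?f \<in> GL2_ring"
    using GL2_ring_minv[OF GL2_ring_mult_left[OF g(1), of h]] .
  \<comment> \<open>The point \<open>minv z ** h\<close> shows that the open set where
    \<open>?f\<close> is nonzero is not empty.\<close>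
  have "h ** minv (minv z ** h) = z"
    using hG zG by (simp add: minv_mult minv_minv minv_GL2 minv_cancel_right)
  then have "?f (minv z ** h) \<noteq> 0" using g(3) by simp
  with zclosure_decided[OF D f zclosure_minv_mult[OF g(2) h]]
  obtain y where y: "y \<in> zclosure X" "?f y \<noteq> 0" "y \<in> D" by blast
  have "minv y \<in> zclosure X" using zclosure_minv_mult[OF y(1) 1] by simp
  then have "h ** minv y \<in> D" using g(4) y(2) zclosure_mult[OF h] by blast
  moreover have "h ** minv y ** y = h"
    using y(1) by (simp add: minv_left zclosure_GL2 flip: matrix_mul_assoc)
  ultimately show ?thesis using y zclosure_GL2 by blast
qed

end

text \<open>Stated for an arbitrary small family because it serves twice, for \<open>H\<close> and
  for the scalars \<open>E\<close>. It comes down to \<open>X = zclosure X\<close>: the closure is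
  definable and closed under left division.\<close>

lemma small_Inter_subgroup:
  assumes \<D>: "\<D> \<prec> (UNIV :: complex set)" "\<And>D. D \<in> \<D> \<Longrightarrow> defm D"
    and X: "X = \<Inter>\<D> \<inter> GL2" and mult: "\<And>x y. x \<in> X \<Longrightarrow> y \<in> X \<Longrightarrow> x ** y \<in> X"
  shows "defm X" and "\<And>x. x \<in> X \<Longrightarrow> minv x \<in> X"
proof -
  have XG: "X \<subseteq> GL2" using X by auto
  have "h \<in> X" if h: "h \<in> zclosure X" for h
  proof -
    have "\<exists>A B. \<forall>D\<in>\<D>. A \<in> GL2 \<and> A \<in> D \<and> B \<in> D \<and> B ** A = h"
    proof (rule saturation_mat[OF \<D>(1)])
      show "constructible (\<lambda>e. mat_of 0 e \<in> GL2 \<and> mat_of 0 e \<in> D \<and> mat_of 4 e \<in> D \<and> mat_of 4 e ** mat_of 0 e = h)"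
        if "D \<in> \<D>" for D
        by (intro constructible.conj constructible_GL2 constructible_mem \<D>(2)[OF that] constructible_mat_eq mterm_mult mterm_mat_of mterm_const)
      fix F assume F: "F \<in> Fpow \<D>"
      have "defm (\<Inter>F)" "X \<subseteq> \<Inter>F" using F \<D>(2) X by (auto simp: Fpow_def intro!: defm_Inter)
      from zclosure_product_of_definable[OF XG mult this h]
      show "\<exists>A B. \<forall>D\<in>F. A \<in> GL2 \<and> A \<in> D \<and> B \<in> D \<and> B ** A = h" by (meson InterD)
    qed
    then obtain A B where AB: "\<forall>D\<in>\<D>. A \<in> GL2 \<and> A \<in> D \<and> B \<in> D \<and> B ** A = h" by blast
    show ?thesis
    proof (cases "\<D> = {}")
      case True
      then show ?thesis using h X by (simp add: zclosure_def)
    next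
      case False
      then have "A \<in> X" "B ** A = h" "B \<in> \<Inter>\<D>" using AB X by auto
      moreover have "B \<in> GL2" using zclosure_GL2[OF XG mult h] \<open>B ** A = h\<close> GL2_mult_iff by blast
      ultimately show ?thesis using X mult by blast
    qed
  qed
  then have eq: "X = zclosure X" using zclosure_inc[OF XG mult] by blast
  then show "defm X" using defm_zclosure by metis
  fix x assume x: "x \<in> X"
  \<comment> \<open>Left division is applied twice: once to reach the identity, and once more to
    reach the inverse.\<close>
  then have "minv x ** (minv x ** x) \<in> X"
    using zclosure_minv_mult[OF XG mult] eq by blast
  then show "minv x \<in> X" using x XG by (auto simp: minv_left)
qed

section \<open>Singular matrices and the main theorem\<close>

lemma scalar_matrix_commute: "mat c ** A = A ** mat c" for A :: mat2
  by (simp add: vec_eq_iff forall_2 matrix_matrix_mult_def sum_2 mat_def mult.commute)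

lemma scalar_matrix_mult: "mat b ** mat c = (mat (b * c) :: mat2)"
  by (simp add: vec_eq_iff forall_2 matrix_matrix_mult_def sum_2 mat_def)

lemma mat2_mult_zero: "0 ** A = (0 :: mat2)" "A ** 0 = (0 :: mat2)" "mat 0 = (0 :: mat2)"
  by (simp_all add: vec_eq_iff matrix_matrix_mult_def mat_def)

lemma det_mat2: "det (mat c :: mat2) = c * c"
  by (simp add: det_2 mat_def)

lemma scalar_GL2: "mat c \<in> GL2 \<longleftrightarrow> c \<noteq> 0"
  by (simp add: GL2_iff det_mat2)

lemma minv_scalar: "c \<noteq> 0 \<Longrightarrow> minv (mat c) = mat (1 / c)"
  by (rule minv_unique[symmetric]) (simp_all add: scalar_GL2 scalar_matrix_mult)

text \<open>A column times a row. For nonzero \<open>x\<close> and \<open>y\<close> the image is the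
  line of \<open>x\<close> and the kernel is the annihilator of \<open>y\<close> under the bilinear
  \<open>dot\<close>, so \<open>x\<close> and \<open>y\<close> are coordinates for the pair (image,
  kernel), and \<open>dot y x\<close> is the trace.\<close>

definition outer :: "complex^2 \<Rightarrow> complex^2 \<Rightarrow> mat2" where
  "outer x y = (\<chi> i j. x $ i * y $ j)"

definition dot :: "complex^2 \<Rightarrow> complex^2 \<Rightarrow> complex" where
  "dot y x = y $ 1 * x $ 1 + y $ 2 * x $ 2"

lemmas mat2_simps = vec_eq_iff forall_2 matrix_matrix_mult_def matrix_vector_mult_def
  vector_matrix_mult_def sum_2 mat_def outer_def dot_def

lemma dot_scale: "dot (c *s y) x = c * dot y x" "dot y (c *s x) = c * dot y x"
  by (simp_all add: dot_def algebra_simps)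

lemma outer_mult: "outer x y ** outer x' y' = mat (dot y x') ** outer x y'"
  by (simp add: mat2_simps algebra_simps)

lemma outer_scale: "mat c ** outer x y = outer (c *s x) y" "outer (c *s x) y = outer x (c *s y)"
  by (simp_all add: mat2_simps algebra_simps)

lemma outer_mult_left: "A ** outer x y = outer (A *v x) y"
  by (simp add: mat2_simps algebra_simps)

lemma outer_eq_0_iff: "outer x y = 0 \<longleftrightarrow> x = 0 \<or> y = 0"
  by (auto simp: mat2_simps)

lemma det_outer: "det (outer x y) = 0"
  by (simp add: det_2 outer_def)

lemma outer_not_GL2: "outer x y \<notin> GL2"
  by (simp add: GL2_iff det_outer)

lemma singular_is_outer:
  assumes "A \<notin> GL2" obtains x y where "A = outer x y"
proof -
  have det: "A $ 1 $ 1 * A $ 2 $ 2 = A $ 1 $ 2 * A $ 2 $ 1" using assms by (simp add: GL2_iff det_2)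
  show ?thesis
  proof (cases "A $ 1 = 0")
    case True
    then have "A = outer (vector [0, 1]) (A $ 2)" by (simp add: mat2_simps)
    then show ?thesis by (rule that)
  next
    case False
    then consider "A $ 1 $ 1 \<noteq> 0" | "A $ 1 $ 2 \<noteq> 0" by (auto simp: vec_eq_iff forall_2)
    then show ?thesis
    proof cases
      case 1
      then have "A = outer (vector [1, A $ 2 $ 1 / A $ 1 $ 1]) (A $ 1)"
        using det by (simp add: mat2_simps field_simps)
      then show ?thesis by (rule that)
    next
      case 2
      then have "A = outer (vector [1, A $ 2 $ 2 / A $ 1 $ 2]) (A $ 1)"
        using det by (simp add: mat2_simps field_simps)
      then show ?thesis by (rule that)
    qed
  qed
qed

lemma dot_zero_parallel:
  assumes "dot y x = 0" "dot y0 x = 0" "x \<noteq> 0" "y0 \<noteq> 0"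
  obtains c where "y = c *s y0"
proof -
  have e: "y $ 1 * x $ 1 = - (y $ 2 * x $ 2)" "y0 $ 1 * x $ 1 = - (y0 $ 2 * x $ 2)"
    using assms(1,2) by (simp_all add: dot_def eq_neg_iff_add_eq_0)
  have "(y $ 1 * y0 $ 2 - y $ 2 * y0 $ 1) * x $ 1 = 0" "(y $ 1 * y0 $ 2 - y $ 2 * y0 $ 1) * x $ 2 = 0"
    using e by algebra+
  then have d: "y $ 1 * y0 $ 2 = y $ 2 * y0 $ 1"
    using assms(3) by (auto simp: vec_eq_iff forall_2)
  consider "y0 $ 1 \<noteq> 0" | "y0 $ 2 \<noteq> 0" using assms(4) by (auto simp: vec_eq_iff forall_2)
  then show ?thesis
  proof cases
    case 1
    then have "y = (y $ 1 / y0 $ 1) *s y0" using d by (simp add: vec_eq_iff forall_2 field_simps)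
    then show ?thesis by (rule that)
  next
    case 2
    then have "y = (y $ 2 / y0 $ 2) *s y0" using d by (simp add: vec_eq_iff forall_2 field_simps)
    then show ?thesis by (rule that)
  qed
qed

lemma dot_commute: "dot x y = dot y x"
  by (simp add: dot_def)

text \<open>Scalars are kept as matrices \<open>mat c\<close>, so that scalar multiplication is a
  matrix product and results about subsets of \<open>GL2\<close> apply to sets of scalars.\<close>

definition scalars :: "mat2 set" where
  "scalars = range mat"

lemma defm_scalars: "defm scalars"
proof -
  have "mat_of 0 e \<in> scalars \<longleftrightarrow> mat_of 0 e $ 1 $ 2 = 0 \<and> mat_of 0 e $ 2 $ 1 = 0 \<and>
      mat_of 0 e $ 1 $ 1 = mat_of 0 e $ 2 $ 2" for e
    by (auto simp: scalars_def mat2_simps image_iff)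
  then show ?thesis
    unfolding defm_def using mterm_mat_of[of 0] unfolding mterm_def by (simp add: constructible.conj constructible.eq0 constructible_eq)
qed

text \<open>The forms taken by an outer matrix variable below one and below two matrix
  quantifiers.\<close>

lemma mterm_shift:
  "mterm (\<lambda>e. mat_of k (\<lambda>n. e (n + m)))" "mterm (\<lambda>e. mat_of k (\<lambda>n. e (n + m + m')))"
  by (simp_all add: mterm_def mat_of_def poly_funs_var)

text \<open>
  The assumption \<open>rect\<close> is all that is needed of \<open>\<pi>(S) = B\<^bsub>F,G\<^esub>\<close>: images and kernels of rank one
  elements can be combined freely, up to scalars.
\<close>

locale mat_monoid =
  fixes M :: "mat2 set" and \<D> :: "mat2 set set"
  assumes one: "mat 1 \<in> M" and mult: "\<And>A B. A \<in> M \<Longrightarrow> B \<in> M \<Longrightarrow> A ** B \<in> M"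
    and zero: "0 \<in> M"
    and small: "\<D> \<prec> (UNIV :: complex set)" and defm: "\<And>D. D \<in> \<D> \<Longrightarrow> defm D"
    and M_eq: "M = \<Inter>\<D>"
    and rect: "\<And>x y x' y'. outer x y \<in> M \<Longrightarrow> outer x' y' \<in> M \<Longrightarrow> outer x y \<noteq> 0 \<Longrightarrow> outer x' y' \<noteq> 0 \<Longrightarrow>
      \<exists>c. c \<noteq> 0 \<and> outer (c *s x) y' \<in> M"
begin

definition H where H_eq: "H = M \<inter> GL2"

lemma M_sub: "D \<in> \<D> \<Longrightarrow> A \<in> M \<Longrightarrow> A \<in> D"
  by (auto simp: M_eq)

lemma H_M: "h \<in> H \<Longrightarrow> h \<in> M" and H_GL2: "h \<in> H \<Longrightarrow> h \<in> GL2"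
  by (auto simp: H_eq)

lemma H_mult: "h \<in> H \<Longrightarrow> k \<in> H \<Longrightarrow> h ** k \<in> H"
  by (simp add: H_eq mult GL2_mult_iff)

lemma H_one: "mat 1 \<in> H"
  by (simp add: H_eq one scalar_GL2)

lemma defm_H: "defm H"
  by (rule small_Inter_subgroup(1)[OF small defm]) (auto simp: H_eq M_eq[symmetric] mult GL2_mult_iff)

lemma definable_submonoidI:
  assumes "defm W"
    and "\<And>h z. h \<in> H \<Longrightarrow> z \<in> W \<Longrightarrow> h ** z \<in> W" "\<And>h z. h \<in> H \<Longrightarrow> z \<in> W \<Longrightarrow> z ** h \<in> W"
    and "\<And>z w. z \<in> W \<Longrightarrow> w \<in> W \<Longrightarrow> z ** w \<in> W"
  shows "definable_submonoid (H \<union> W)"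
proof -
  have "submonoid (H \<union> W) M2"
    by (rule submonoid.intro) (use assms(2-) H_mult H_one in \<open>auto simp: M2_def\<close>)
  moreover have "defm (H \<union> W)"
    using constructible_disj[OF defm_H[unfolded defm_def] assms(1)[unfolded defm_def]] by (simp add: defm_def)
  ultimately show ?thesis by (simp add: definable_submonoid_def definable_mat_iff_defm)
qed

text \<open>For a nonzero singular \<open>outer x y\<close> in \<open>M\<close>, \<open>rect\<close>
  puts multiples of \<open>outer x0 y\<close> and \<open>outer x y0\<close> into \<open>M\<close>;
  that their traces vanish forces \<open>y\<close> parallel to \<open>y0\<close> and
  \<open>x\<close> to \<open>x0\<close> in the plane. Multiples of \<open>n\<close> multiply to 0,
  so closure under products concerns only factors from \<open>H\<close>.\<close>

lemma nilpotent_case: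
  assumes D: "D \<in> \<D>" and nil: "\<And>x y. outer x y \<in> M \<Longrightarrow> dot y x = 0"
  shows "\<exists>N. definable_submonoid N \<and> M \<subseteq> N \<and> N \<subseteq> D"
proof -
  have "\<exists>n\<in>M. n ** n = 0 \<and> n \<notin> GL2 \<and> (\<forall>A\<in>M. A \<notin> GL2 \<longrightarrow> (\<exists>c. A = mat c ** n))"
  proof (cases "\<exists>n\<in>M. n \<notin> GL2 \<and> n \<noteq> 0")
    case False
    then show ?thesis using zero by (intro bexI[of _ 0]) (auto simp: GL2_iff det_2)
  next
    case True
    then obtain x0 y0 where n: "outer x0 y0 \<in> M" "outer x0 y0 \<noteq> 0" by (metis singular_is_outer)
    have "\<exists>c. A = mat c ** outer x0 y0" if A: "A \<in> M" "A \<notin> GL2" for A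
    proof -
      obtain x y where xy: "A = outer x y" using A singular_is_outer by blast
      show ?thesis
      proof (cases "A = 0")
        case True
        then show ?thesis by (intro exI[of _ 0]) (simp add: mat2_simps)
      next
        case False
        note nz = False[unfolded xy] n(2)
        obtain c where "c \<noteq> 0" "outer (c *s x0) y \<in> M" using rect[OF n(1) A(1)[unfolded xy] n(2) nz(1)] by blast
        then have "dot y x0 = 0" using nil[of "c *s x0" y] by (simp add: dot_scale)
        with nil[OF n(1)] n(2) obtain a where a: "y = a *s y0"
          using dot_zero_parallel[of y x0 y0] by (auto simp: outer_eq_0_iff)
        obtain c where "c \<noteq> 0" "outer (c *s x) y0 \<in> M" using rect[OF A(1)[unfolded xy] n(1) nz] by blast
        then have "dot y0 x = 0" using nil[of "c *s x" y0] by (simp add: dot_scale)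
        with nil[OF n(1)] n(2) obtain b where b: "x = b *s x0"
          using dot_zero_parallel[of x y0 x0] by (auto simp: outer_eq_0_iff dot_commute)
        have "A = mat (a * b) ** outer x0 y0" unfolding xy a b by (simp add: mat2_simps)
        then show ?thesis ..
      qed
    qed
    moreover have "outer x0 y0 ** outer x0 y0 = 0"
      using nil[OF n(1)] by (simp add: outer_mult)
    ultimately show ?thesis using n(1) outer_not_GL2 by (intro bexI[of _ "outer x0 y0"]) auto
  qed
  then obtain n where n: "n \<in> M" "n ** n = 0" "n \<notin> GL2"
    and all: "\<And>A. A \<in> M \<Longrightarrow> A \<notin> GL2 \<Longrightarrow> \<exists>c. A = mat c ** n" by blast
  define W where "W = {A. (\<exists>B. B \<in> scalars \<and> A = B ** n) \<and> (\<forall>h\<in>H. \<forall>k\<in>H. h ** A ** k \<in> D)}"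
  have "defm W"
    unfolding defm_def W_def mem_Collect_eq
    by (intro constructible.conj constructible_ex_mat constructible_ball_mat defm_H constructible_mem defm[OF D] constructible_mem[OF defm_scalars] constructible_mat_eq
        mterm_mult mterm_const mterm_mat_of mterm_shift)
  moreover have W_iff: "A \<in> W \<longleftrightarrow> (\<exists>c. A = mat c ** n) \<and> (\<forall>h\<in>H. \<forall>k\<in>H. h ** A ** k \<in> D)" for A
    by (auto simp: W_def scalars_def)
  have "h ** A \<in> W" if h: "h \<in> H" and A: "A \<in> W" for h A
  proof -
    obtain c where c: "A = mat c ** n" using A W_iff by blast
    \<comment> \<open>\<open>h ** n\<close> is again a singular element of \<open>M\<close>, hence a
      multiple of \<open>n\<close>; so \<open>H\<close> acts on the line of \<open>n\<close>,
      including multiples outside \<open>M\<close>.\<close>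
    obtain d where "h ** n = mat d ** n"
      using all[of "h ** n"] h n by (auto simp: mult H_M GL2_mult_iff)
    then have "h ** A = mat (c * d) ** n"
      by (simp add: c matrix_mul_assoc flip: scalar_matrix_mult) (metis matrix_mul_assoc scalar_matrix_commute)
    moreover have "h' ** (h ** A) ** k \<in> D" if "h' \<in> H" "k \<in> H" for h' k
      using A H_mult[OF that(1) h] that by (simp add: W_iff matrix_mul_assoc)
    ultimately show ?thesis by (auto simp: W_iff)
  qed
  moreover have "A ** h \<in> W" if h: "h \<in> H" and A: "A \<in> W" for h A
  proof -
    obtain c where c: "A = mat c ** n" using A W_iff by blast
    obtain d where "n ** h = mat d ** n"
      using all[of "n ** h"] h n by (auto simp: mult H_M GL2_mult_iff)
    then have "A ** h = mat (c * d) ** n"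
      by (simp add: c flip: scalar_matrix_mult matrix_mul_assoc)
    moreover have "h' ** (A ** h) ** k \<in> D" if "h' \<in> H" "k \<in> H" for h' k
      using A H_mult[OF h that(2)] that by (auto simp: W_iff simp flip: matrix_mul_assoc)
    ultimately show ?thesis by (auto simp: W_iff)
  qed
  moreover have "0 \<in> W"
    using M_sub[OF D zero] by (auto simp: W_iff mat2_mult_zero intro!: exI[of _ 0])
  moreover have "A ** B = 0" if W: "A \<in> W" "B \<in> W" for A B
  proof -
    obtain c d where "A = mat c ** n" "B = mat d ** n" using W W_iff by blast
    then have "A ** B = mat c ** mat d ** (n ** n)"
      by (metis matrix_mul_assoc scalar_matrix_commute)
    then show ?thesis by (simp add: n(2))
  qed
  ultimately have "definable_submonoid (H \<union> W)"
    by (intro definable_submonoidI) auto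
  moreover have "M \<subseteq> H \<union> W"
  proof
    fix A assume A: "A \<in> M"
    have "h ** A ** k \<in> D" if "h \<in> H" "k \<in> H" for h k
      by (simp add: M_sub[OF D] mult H_M that A)
    then show "A \<in> H \<union> W"
      using all[OF A] A by (cases "A \<in> GL2") (simp_all add: W_iff H_eq)
  qed
  moreover have "H \<union> W \<subseteq> D"
    using M_sub[OF D] H_M H_one by (force simp: W_iff)
  ultimately show ?thesis by blast
qed

lemma idempotent_case:
  assumes D: "D \<in> \<D>" and xy: "outer x y \<in> M" "dot y x \<noteq> 0"
  shows "\<exists>N. definable_submonoid N \<and> M \<subseteq> N \<and> N \<subseteq> D"
proof -
  define x0 where "x0 = x"
  \<comment> \<open>The scaling makes \<open>outer x0 y0\<close> idempotent. Whether this particular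
    multiple of the given element lies in \<open>M\<close> is not known yet; it follows once
    \<open>E\<close> is a group.\<close>
  define y0 where "y0 = (1 / dot y x) *s y"
  have dot1: "dot y0 x0 = 1" using xy by (simp add: x0_def y0_def dot_scale)
  then have nz: "x0 \<noteq> 0" "y0 \<noteq> 0" by (auto simp: dot_def)
  define e where "e = outer x0 y0"
  have ee: "e ** e = e" by (simp add: e_def outer_mult dot1)
  define E where "E = {k \<in> scalars. k ** e \<in> M} \<inter> GL2"
  have E_iff: "mat c \<in> E \<longleftrightarrow> c \<noteq> 0 \<and> outer (c *s x0) y0 \<in> M" for c
    by (auto simp: E_def scalars_def scalar_GL2 e_def outer_scale)
  have E_scalar: "\<exists>c. k = mat c \<and> c \<noteq> 0" if "k \<in> E" for k
    using that by (auto simp: E_def scalars_def scalar_GL2)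
  have E_mult: "k ** l \<in> E" if k: "k \<in> E" and l: "l \<in> E" for k l
  proof -
    obtain b c where bc: "k = mat b" "l = mat c" using E_scalar k l by blast
    have "(k ** e) ** (l ** e) = k ** l ** (e ** e)"
      unfolding bc by (metis matrix_mul_assoc scalar_matrix_commute)
    moreover have "(k ** e) ** (l ** e) \<in> M" using k l by (auto simp: E_def intro: mult)
    moreover have "k ** l \<in> scalars" by (simp add: bc scalar_matrix_mult scalars_def)
    ultimately show ?thesis using k l by (simp add: E_def ee GL2_mult_iff)
  qed
  define \<E> where "\<E> = (\<lambda>D. {k. k \<in> scalars \<and> k ** e \<in> D}) ` \<D>"
  \<comment> \<open>\<open>D\<close> shows that the family is nonempty; an empty intersection would
    lose the condition \<open>k \<in> scalars\<close>.\<close>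
  have E_Inter: "E = \<Inter>\<E> \<inter> GL2" using D by (auto simp: E_def \<E>_def M_eq)
  have \<E>_small: "\<E> \<prec> (UNIV :: complex set)"
    unfolding \<E>_def by (rule lesspoll_trans1[OF image_lepoll small])
  have \<E>_defm: "defm C" if C: "C \<in> \<E>" for C
  proof -
    obtain D' where D': "C = {k. k \<in> scalars \<and> k ** e \<in> D'}" "D' \<in> \<D>" using C unfolding \<E>_def by blast
    show ?thesis
      unfolding defm_def D'(1) mem_Collect_eq
      by (intro constructible.conj constructible_mem[OF defm_scalars] constructible_mem defm[OF D'(2)] mterm_mult mterm_const mterm_mat_of mterm_shift)
  qed
  have E_defm: "defm E"
    by (rule small_Inter_subgroup(1)[OF \<E>_small \<E>_defm E_Inter E_mult])
  have E_minv: "minv k \<in> E" if "k \<in> E" for k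
    by (rule small_Inter_subgroup(2)[OF \<E>_small \<E>_defm E_Inter E_mult that])
  have E_divide: "mat (b / c) \<in> E" if "mat b \<in> E" "mat c \<in> E" for b c
  proof -
    have "c \<noteq> 0" using that(2) by (simp add: E_iff)
    then have "mat (1 / c) \<in> E" using E_minv[OF that(2)] by (simp add: minv_scalar)
    from E_mult[OF that(1) this] show ?thesis by (simp add: scalar_matrix_mult)
  qed
  \<comment> \<open>The given element \<open>outer x y\<close> is \<open>dot y x\<close> times
    \<open>e\<close>. Dividing this member of \<open>E\<close> by itself gives 1, that is,
    \<open>e\<close> itself lies in \<open>M\<close>.\<close>
  have "mat (dot y x) \<in> E"
    using xy by (simp add: E_iff outer_scale x0_def y0_def)
  from E_divide[OF this this] xy(2) have E_one: "mat 1 \<in> E" by simp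
  then have e_M: "outer x0 y0 \<in> M" by (simp add: E_iff)
  have E_e: "k ** e \<in> M" if "k \<in> E" for k using that by (simp add: E_def)

  \<comment> \<open>For \<open>A = outer u v\<close>, \<open>rect\<close> yields
    \<open>c1 *s u\<close> paired with \<open>y0\<close> and \<open>c2 *s x0\<close> paired with
    \<open>v\<close>; the product is \<open>A\<close> times c1 * c2, so 1 / (c1 * c2) should lie in
    \<open>E\<close>. If some \<open>y1\<close> and \<open>x1\<close> pair nontrivially with
    \<open>u\<close> and \<open>v\<close>, three products that are multiples of \<open>e\<close> put
    a * b, c1 * a and c2 * b into \<open>E\<close>, and the quotient is the required scalar.
    Otherwise \<open>A\<close> is fixed by \<open>e\<close> on one side and factors through
    \<open>e\<close>.\<close>
  have decomposition: "\<exists>x' y'. outer x' y0 \<in> M \<and> outer x0 y' \<in> M \<and> A = outer x' y0 ** outer x0 y'"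
    if A: "A \<in> M" "A \<notin> GL2" for A
  proof -
    obtain u v where uv: "A = outer u v" using A(2) singular_is_outer by blast
    show ?thesis
    proof (cases "A = 0")
      case True
      have "outer 0 y0 = 0" "outer x0 0 = 0" by (simp_all add: outer_eq_0_iff)
      then show ?thesis using True zero by (intro exI[of _ 0]) simp
    next
      case False
      then have uv_nz: "u \<noteq> 0" "v \<noteq> 0" by (auto simp: uv outer_eq_0_iff)
      have outer_nz: "outer u v \<noteq> 0" "outer x0 y0 \<noteq> 0" using uv_nz nz by (auto simp: outer_eq_0_iff)
      obtain c1 where c1: "c1 \<noteq> 0" "outer (c1 *s u) y0 \<in> M"
        using rect[OF A(1)[unfolded uv] e_M outer_nz] by blast
      obtain c2 where c2: "c2 \<noteq> 0" "outer (c2 *s x0) v \<in> M"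
        using rect[OF e_M A(1)[unfolded uv] outer_nz(2,1)] by blast
      have c2': "outer x0 (c2 *s v) \<in> M" using c2(2) by (simp add: outer_scale)
      consider x1 y1 where "outer x0 y1 \<in> M" "outer x1 y0 \<in> M" "dot y1 u \<noteq> 0" "dot v x1 \<noteq> 0"
        | "\<And>y1. outer x0 y1 \<in> M \<Longrightarrow> dot y1 u = 0" | "\<And>x1. outer x1 y0 \<in> M \<Longrightarrow> dot v x1 = 0" by blast
      then show ?thesis
      proof cases
        case (1 x1 y1)
        let ?a = "dot y1 u" and ?b = "dot v x1"
        have "outer x0 y1 ** outer u v ** outer x1 y0 \<in> M" by (intro mult 1 A(1)[unfolded uv])
        also have "outer x0 y1 ** outer u v ** outer x1 y0 = outer ((?a * ?b) *s x0) y0"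
          by (simp add: outer_mult outer_scale(1) vector_smult_assoc mult.commute)
        finally have "mat (?a * ?b) \<in> E" using 1 by (simp add: E_iff)
        moreover have "outer x0 y1 ** outer (c1 *s u) y0 \<in> M" by (intro mult 1 c1)
        then have "mat (c1 * ?a) \<in> E" using 1 c1 by (simp add: E_iff outer_mult outer_scale(1) dot_scale)
        moreover have "outer x0 (c2 *s v) ** outer x1 y0 \<in> M" by (intro mult 1 c2')
        then have "mat (c2 * ?b) \<in> E" using 1 c2 by (simp add: E_iff outer_mult outer_scale(1) dot_scale)
        ultimately have "mat (?a * ?b / ((c1 * ?a) * (c2 * ?b))) \<in> E"
          using E_mult E_divide by (metis scalar_matrix_mult)
        moreover have "?a * ?b / ((c1 * ?a) * (c2 * ?b)) = 1 / (c1 * c2)" using 1 by simp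
        ultimately have "outer ((1 / (c1 * c2)) *s x0) y0 \<in> M" by (simp add: E_iff)
        then have "outer (c1 *s u) y0 ** outer ((1 / (c1 * c2)) *s x0) y0 \<in> M" by (intro mult c1)
        then have "outer ((1 / c2) *s u) y0 \<in> M"
          using c1(1) by (simp add: outer_mult outer_scale(1) dot_scale dot1 vector_smult_assoc)
        moreover have "A = outer ((1 / c2) *s u) y0 ** outer x0 (c2 *s v)"
          using c2(1) by (simp add: outer_mult dot1 dot_scale uv outer_scale vector_smult_assoc)
        ultimately show ?thesis using c2' by blast
      next
        case 2
        have "dot v u = 0" using 2[OF c2'] c2(1) by (simp add: dot_scale)
        \<comment> \<open>Both \<open>v\<close> and \<open>y0\<close> annihilate the nonzero vector
          \<open>u\<close> of the plane, so they are parallel.\<close>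
        then obtain d where d: "v = d *s y0" using 2[OF e_M] uv_nz nz dot_zero_parallel by blast
        have "A = outer (d *s u) y0" by (simp add: uv d outer_scale)
        moreover have "A = A ** e" by (simp add: uv d e_def outer_mult dot_scale dot1 outer_scale)
        ultimately show ?thesis using A(1) e_M e_def by metis
      next
        case 3
        have "dot v u = 0" using 3[OF c1(2)] c1(1) by (simp add: dot_scale)
        then obtain d where d: "u = d *s x0"
          using 3[OF e_M] uv_nz nz dot_zero_parallel[of u v x0] by (metis dot_commute)
        have "A = outer x0 (d *s v)" by (simp add: uv d outer_scale)
        moreover have "A = e ** A" by (simp add: uv d e_def outer_mult dot_scale dot1 outer_scale)
        ultimately show ?thesis using A(1) e_M e_def by metis
      qed
    qed
  qed

  \<comment> \<open>What has to survive the passage from \<open>M\<close> to a definable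
    \<open>D'\<close>: the first clause keeps P ** Q inside \<open>D\<close>, the second controls
    the middle factor in a product of two elements of P ** Q. It is constructible because
    \<open>E\<close> is definable.\<close>
  define R where "R A B \<longleftrightarrow> A ** B \<in> D \<and>
    (e ** A = A \<and> B ** e = B \<longrightarrow> A ** B = 0 \<or> (\<exists>k. k \<in> E \<and> A ** B = k ** e))" for A B :: mat2
  have R_con: "constructible (\<lambda>e. R (mat_of 0 e) (mat_of 4 e))"
    unfolding R_def
    by (intro constructible.conj constructible_imp constructible_disj constructible_ex_mat constructible_mem defm[OF D] E_defm constructible_mat_eq
        mterm_mult mterm_const mterm_mat_of mterm_shift)
  have R_M: "R A B" if "A \<in> \<Inter>\<D>" "B \<in> \<Inter>\<D>" for A B
    unfolding R_def
  proof (intro conjI impI)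
    have AB: "A ** B \<in> M" using that by (simp only: M_eq[symmetric] mult)
    then show "A ** B \<in> D" by (rule M_sub[OF D])
    assume *: "e ** A = A \<and> B ** e = B"
    let ?s = "dot y0 ((A ** B) *v x0)"
    \<comment> \<open>Compression by \<open>e = outer x0 y0\<close> on both sides turns any matrix
      into a multiple of \<open>e\<close>; the factor is \<open>?s\<close>.\<close>
    have "A ** B = e ** (A ** B) ** e" using * by (metis matrix_mul_assoc)
    also have "\<dots> = e ** ((A ** B) ** e)" by (simp add: matrix_mul_assoc)
    also have "\<dots> = mat ?s ** e" by (simp only: e_def outer_mult_left[of "A ** B"] outer_mult)
    finally have eq: "A ** B = mat ?s ** e" .
    show "A ** B = 0 \<or> (\<exists>k. k \<in> E \<and> A ** B = k ** e)"
    proof (cases "?s = 0")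
      case True
      then show ?thesis using eq by (simp add: mat2_simps)
    next
      case False
      then have "mat ?s \<in> E" using AB eq by (simp add: E_def scalars_def scalar_GL2)
      then show ?thesis using eq by blast
    qed
  qed
  obtain D' where D': "defm D'" "\<Inter>\<D> \<subseteq> D'" "\<And>A B. A \<in> D' \<Longrightarrow> B \<in> D' \<Longrightarrow> R A B"
    using compactness_mat[OF small defm R_con R_M] by blast
  have M_D': "A \<in> D'" if "A \<in> M" for A using that D'(2) M_eq by blast

  \<comment> \<open>Stability under \<open>E\<close> lets \<open>A\<close> absorb the scalar of a
    middle product, and stability under \<open>H\<close> gives the action of \<open>H\<close>.
    Taking both multipliers to be 1 shows that the set lies in \<open>D'\<close>.\<close>
  define P where "P = {A. A ** e = A \<and> (\<forall>h\<in>H. \<forall>k\<in>E. k ** (h ** A) \<in> D')}"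
  define Q where "Q = {B. e ** B = B \<and> (\<forall>h\<in>H. \<forall>k\<in>E. k ** (B ** h) \<in> D')}"
  define W where "W = {Z. \<exists>A. A \<in> P \<and> (\<exists>B. B \<in> Q \<and> Z = A ** B)}"
  have defm_P: "defm P"
    unfolding defm_def P_def mem_Collect_eq
    by (intro constructible.conj constructible_ball_mat constructible_mem D' defm_H E_defm constructible_mat_eq mterm_mult mterm_const mterm_mat_of mterm_shift)
  have defm_Q: "defm Q"
    unfolding defm_def Q_def mem_Collect_eq
    by (intro constructible.conj constructible_ball_mat constructible_mem D' defm_H E_defm constructible_mat_eq mterm_mult mterm_const mterm_mat_of mterm_shift)
  have "defm W"
    unfolding defm_def W_def mem_Collect_eq
    by (intro constructible.conj constructible_ex_mat constructible_mem defm_P defm_Q constructible_mat_eq mterm_mult mterm_const mterm_mat_of mterm_shift)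
  moreover have P_left: "h ** A \<in> P" if h: "h \<in> H" and A: "A \<in> P" for h A
  proof -
    have "k ** (h' ** (h ** A)) \<in> D'" if "h' \<in> H" "k \<in> E" for h' k
    proof -
      have "k ** ((h' ** h) ** A) \<in> D'" using A H_mult[OF that(1) h] that(2) by (simp add: P_def)
      then show ?thesis by (simp add: matrix_mul_assoc)
    qed
    moreover have "(h ** A) ** e = h ** A" using A by (simp add: P_def flip: matrix_mul_assoc)
    ultimately show ?thesis by (simp add: P_def)
  qed
  moreover have Q_right: "B ** h \<in> Q" if h: "h \<in> H" and B: "B \<in> Q" for h B
  proof -
    have "k ** ((B ** h) ** h') \<in> D'" if "h' \<in> H" "k \<in> E" for h' k
    proof -
      have "k ** (B ** (h ** h')) \<in> D'" using B H_mult[OF h that(1)] that(2) by (simp add: Q_def)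
      then show ?thesis by (simp add: matrix_mul_assoc)
    qed
    moreover have "e ** (B ** h) = B ** h" using B by (simp add: Q_def matrix_mul_assoc)
    ultimately show ?thesis by (simp add: Q_def)
  qed
  have P_scalar: "A ** k \<in> P" if k: "k \<in> E" and A: "A \<in> P" for k A
  proof -
    obtain c where c: "k = mat c" using E_scalar[OF k] by blast
    have comm: "B ** k = k ** B" for B by (simp only: c scalar_matrix_commute)
    have "A ** k ** e = k ** (A ** e)" by (simp only: comm matrix_mul_assoc)
    then have "A ** k ** e = A ** k" using A by (simp add: P_def comm)
    moreover have "l ** (h ** (A ** k)) \<in> D'" if "h \<in> H" "l \<in> E" for h l
    proof -
      have "l ** (h ** (A ** k)) = (l ** k) ** (h ** A)"
        using comm[of "h ** A"] by (simp only: matrix_mul_assoc[symmetric])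
      then show ?thesis using A that E_mult[OF that(2) k] by (simp add: P_def)
    qed
    ultimately show ?thesis by (simp add: P_def)
  qed
  have P_D': "A \<in> D'" if "A \<in> P" for A using that H_one E_one unfolding P_def by force
  have Q_D': "B \<in> D'" if "B \<in> Q" for B using that H_one E_one unfolding Q_def by force
  have zero_PQ: "0 \<in> P" "0 \<in> Q" using M_D'[OF zero] by (simp_all add: P_def Q_def)
  have "z ** w \<in> W" if zw: "z \<in> W" "w \<in> W" for z w
  proof -
    obtain A B A' B' where AB: "A \<in> P" "B \<in> Q" "z = A ** B" "A' \<in> P" "B' \<in> Q" "w = A' ** B'"
      using zw by (auto simp: W_def)
    have "R B A'" by (intro D'(3) P_D' Q_D' AB)
    then consider "B ** A' = 0" | k where "k \<in> E" "B ** A' = k ** e"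
      using AB by (auto simp: R_def P_def Q_def)
    then show ?thesis
    proof cases
      case 1
      have "z ** w = A ** (B ** A') ** B'" by (simp add: AB matrix_mul_assoc)
      then have "z ** w = 0 ** 0" by (simp add: 1)
      then show ?thesis using zero_PQ unfolding W_def by blast
    next
      case 2
      have "z ** w = A ** (B ** A') ** B'" by (simp add: AB matrix_mul_assoc)
      also have "\<dots> = (A ** k) ** (e ** B')" by (simp add: 2 matrix_mul_assoc)
      also have "e ** B' = B'" using AB by (simp add: Q_def)
      finally show ?thesis using P_scalar[OF 2(1) AB(1)] AB(5) unfolding W_def by blast
    qed
  qed
  moreover have "h ** z \<in> W" if "h \<in> H" "z \<in> W" for h z
    using that P_left unfolding W_def by clarify (metis matrix_mul_assoc)
  moreover have "z ** h \<in> W" if "h \<in> H" "z \<in> W" for h z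
    using that Q_right unfolding W_def by clarify (metis matrix_mul_assoc)
  ultimately have "definable_submonoid (H \<union> W)" by (intro definable_submonoidI)
  moreover have "M \<subseteq> H \<union> W"
  proof
    fix A assume A: "A \<in> M"
    show "A \<in> H \<union> W"
    proof (cases "A \<in> GL2")
      case False
      then obtain x' y' where xy': "outer x' y0 \<in> M" "outer x0 y' \<in> M" "A = outer x' y0 ** outer x0 y'"
        using decomposition A by blast
      have ex: "outer x' y0 ** e = outer x' y0" and ey: "e ** outer x0 y' = outer x0 y'"
        by (simp_all add: e_def outer_mult dot1)
      have "k ** (h ** outer x' y0) \<in> D'" if "h \<in> H" "k \<in> E" for h k
      proof -
        \<comment> \<open>\<open>k\<close> itself may lie outside \<open>M\<close>, but
          \<open>k ** e\<close> is in \<open>M\<close>; so the scalar is moved next to an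
          \<open>e\<close> supplied by \<open>outer x' y0 ** e = outer x' y0\<close>.\<close>
        have "k ** (h ** outer x' y0) = h ** (outer x' y0 ** (k ** e))"
          using E_scalar[OF that(2)] ex by (metis matrix_mul_assoc scalar_matrix_commute)
        then show ?thesis using that xy' by (simp add: M_D' mult H_M E_e)
      qed
      moreover have "k ** (outer x0 y' ** h) \<in> D'" if "h \<in> H" "k \<in> E" for h k
      proof -
        have "k ** (outer x0 y' ** h) = (k ** e) ** outer x0 y' ** h"
          using ey by (metis matrix_mul_assoc)
        then show ?thesis using that xy' by (simp add: M_D' mult H_M E_e)
      qed
      ultimately have "outer x' y0 \<in> P" "outer x0 y' \<in> Q" using ex ey by (simp_all add: P_def Q_def)
      then show ?thesis using xy'(3) unfolding W_def by blast
    qed (use A in \<open>simp add: H_eq\<close>)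
  qed
  moreover have "H \<union> W \<subseteq> D"
  proof
    fix Z assume "Z \<in> H \<union> W"
    then show "Z \<in> D"
    proof
      assume "Z \<in> W"
      then obtain A B where "A \<in> P" "B \<in> Q" "Z = A ** B" by (auto simp: W_def)
      then show ?thesis using D'(3)[OF P_D' Q_D'] by (simp add: R_def)
    qed (simp add: M_sub[OF D] H_M)
  qed
  ultimately show ?thesis by blast
qed

lemma small_Inter_of_definable_submonoid: "small_Inter_of definable_submonoid M"
proof -
  have "\<exists>N. definable_submonoid N \<and> M \<subseteq> N \<and> N \<subseteq> D" if "D \<in> \<D>" for D
    using nilpotent_case[OF that] idempotent_case[OF that] by blast
  then obtain N where N: "\<And>D. D \<in> \<D> \<Longrightarrow> definable_submonoid (N D) \<and> M \<subseteq> N D \<and> N D \<subseteq> D" by metis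
  have "N ` \<D> \<prec> (UNIV :: complex set)" by (rule lesspoll_trans1[OF image_lepoll small])
  moreover have "M = \<Inter>(N ` \<D>)" using N M_eq by blast
  ultimately show ?thesis using N unfolding small_Inter_of_def by blast
qed

end

section \<open>Images and kernels of projective classes, and the conclusion\<close>

lemma mem_PM2_proj: "B \<in> PM2_proj A \<longleftrightarrow> (\<exists>c. c \<noteq> 0 \<and> B = mat c ** A)"
proof -
  have "(\<chi> i j. c * A $ i $ j) = mat c ** A" for c by (simp add: mat2_simps)
  then show ?thesis by (simp add: PM2_proj_def scalar_rel_def)
qed

lemma PM2_proj_eqD: "PM2_proj A = PM2_proj B \<Longrightarrow> \<exists>c. c \<noteq> 0 \<and> A = mat c ** B"
  using mem_PM2_proj[of A A] mem_PM2_proj[of A B] by (metis matrix_mul_lid zero_neq_one)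

lemma mat_image_scale: "c \<noteq> 0 \<Longrightarrow> mat_image (mat c ** A) = mat_image A"
proof -
  assume c: "c \<noteq> 0"
  have *: "(mat c ** A) *v v = A *v (c *s v)" for v
    by (simp add: mat2_simps algebra_simps)
  have "surj (\<lambda>v :: complex^2. c *s v)"
    by (rule surjI[of _ "\<lambda>v. (1 / c) *s v"]) (simp add: c vector_smult_assoc)
  moreover have "mat_image (mat c ** A) = (*v) A ` range (\<lambda>v. c *s v)"
    by (simp add: mat_image_def * image_image)
  ultimately show ?thesis by (simp add: mat_image_def)
qed

lemma mat_kernel_scale: "c \<noteq> 0 \<Longrightarrow> mat_kernel (mat c ** A) = mat_kernel A"
proof -
  assume c: "c \<noteq> 0"
  have "(mat c ** A) *v v = c *s (A *v v)" for v
    by (simp add: mat2_simps algebra_simps)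
  then show ?thesis using c by (simp add: mat_kernel_def)
qed

lemma outer_vec: "outer x y *v v = dot y v *s x"
  by (simp add: mat2_simps algebra_simps)

lemma mat_kernel_outer: "x \<noteq> 0 \<Longrightarrow> mat_kernel (outer x y) = {v. dot y v = 0}"
  by (simp add: mat_kernel_def outer_vec)

lemma mat_image_outer:
  assumes "y \<noteq> 0" shows "mat_image (outer x y) = range (\<lambda>c. c *s x)"
proof -
  have "surj (dot y)"
  proof (rule surjI)
    fix c
    have "y $ 1 \<noteq> 0 \<or> y $ 2 \<noteq> 0" using assms by (auto simp: vec_eq_iff forall_2)
    then show "dot y (if y $ 1 \<noteq> 0 then vector [c / y $ 1, 0] else vector [0, c / y $ 2]) = c"
      by (auto simp: dot_def)
  qed
  moreover have "mat_image (outer x y) = (\<lambda>c. c *s x) ` range (dot y)"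
    by (simp add: mat_image_def outer_vec image_image)
  ultimately show ?thesis by simp
qed

lemma rank_outer:
  assumes "x \<noteq> 0" "y \<noteq> 0" shows "rank (outer x y) = 1"
proof -
  have rows: "rows (outer x y) = {x $ 1 *s y, x $ 2 *s y}"
  proof -
    have "row i (outer x y) = x $ i *s y" for i by (simp add: row_def outer_def vec_eq_iff)
    then show ?thesis by (auto simp: rows_def) (metis exhaust_2)
  qed
  have "vec.span (rows (outer x y)) = vec.span {y}"
    unfolding vec.span_eq
  proof
    show "rows (outer x y) \<subseteq> vec.span {y}"
      unfolding rows by (auto intro: vec.span_scale vec.span_base)
    obtain i where i: "x $ i \<noteq> 0" "x $ i *s y \<in> rows (outer x y)"
      using assms(1) unfolding rows by (auto simp: vec_eq_iff forall_2)
    have "(1 / x $ i) *s (x $ i *s y) \<in> vec.span (rows (outer x y))"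
      by (intro vec.span_scale vec.span_base i)
    then show "{y} \<subseteq> vec.span (rows (outer x y))" using i by (simp add: vector_smult_assoc)
  qed
  then have "vec.dim (rows (outer x y)) = vec.dim {y}" by (metis vec.dim_span)
  also have "\<dots> = 1"
    using assms(2) by (subst vec.dim_eq_card_independent) simp_all
  finally show ?thesis by (simp add: row_rank_def_gen)
qed

theorem theorem4p16:
  fixes M H S :: "mat2 set" and F G :: "(complex^2) set set"
  assumes "submonoid M M2"
    and "inf_definable M"
    and "H = M \<inter> GL2"
    and "S = M \<inter> M20"
    and "M = H \<union> S"
    and "F \<subseteq> CP1" and "G \<subseteq> CP1"
    and "PM2_proj ` S = B_set F G"
  shows "small_Inter_of definable_submonoid M"
proof -
  interpret submonoid M M2 by fact
  obtain \<D> where \<D>: "\<D> \<prec> (UNIV :: complex set)" "\<And>D. D \<in> \<D> \<Longrightarrow> definable_mat D" "M = \<Inter>\<D>"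
    using assms(2) unfolding inf_definable_def small_Inter_of_def by blast
  have in_B: "mat_image (outer x y) \<in> F \<and> mat_kernel (outer x y) \<in> G"
    if "outer x y \<in> M" "outer x y \<noteq> 0" for x y
  proof -
    have "outer x y \<in> S" using that by (simp add: assms(4) M20_def det_outer)
    then have "PM2_proj (outer x y) \<in> B_set F G" using assms(8) by blast
    moreover have "PM2_proj (outer x y) \<noteq> PM2_proj 0"
      using that(2) PM2_proj_eqD[of "outer x y" 0] by auto
    ultimately obtain A where A: "mat_image A \<in> F" "mat_kernel A \<in> G" "PM2_proj (outer x y) = PM2_proj A"
      by (auto simp: B_set_def)
    then show ?thesis using PM2_proj_eqD[OF A(3)] mat_image_scale mat_kernel_scale by metis
  qed
  \<comment> \<open>\<open>outer x y'\<close> has the image of the first matrix and the kernel of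
    the second, so its class lies in \<open>B_set F G\<close> and has a representative in
    \<open>S\<close>; that representative is determined only up to the scalar
    \<open>c\<close>.\<close>
  have rect: "\<exists>c. c \<noteq> 0 \<and> outer (c *s x) y' \<in> M"
    if "outer x y \<in> M" "outer x' y' \<in> M" "outer x y \<noteq> 0" "outer x' y' \<noteq> 0" for x y x' y'
  proof -
    have nz: "x \<noteq> 0" "y \<noteq> 0" "x' \<noteq> 0" "y' \<noteq> 0" using that(3,4) by (auto simp: outer_eq_0_iff)
    have "mat_image (outer x y') \<in> F" "mat_kernel (outer x y') \<in> G"
      using in_B[OF that(1,3)] in_B[OF that(2,4)] nz by (simp_all add: mat_image_outer mat_kernel_outer)
    then have "PM2_proj (outer x y') \<in> B_set F G"
      using rank_outer nz by (auto simp: B_set_def)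
    then obtain s where s: "s \<in> S" "PM2_proj s = PM2_proj (outer x y')" unfolding assms(8)[symmetric] by auto
    from PM2_proj_eqD[OF s(2)] s(1) show ?thesis by (auto simp: assms(4) outer_scale)
  qed
  \<comment> \<open>The zero class has 0 as its only representative, so 0 itself must lie in
    \<open>M\<close>.\<close>
  have "PM2_proj 0 \<in> PM2_proj ` S" unfolding assms(8) by (simp add: B_set_def)
  then obtain s where "s \<in> S" "PM2_proj 0 = PM2_proj s" by blast
  then have zero: "0 \<in> M"
    using PM2_proj_eqD[of s 0] by (auto simp: assms(4))
  interpret mat_monoid M \<D>
  proof
    show "mat 1 \<in> M" "\<And>A B. A \<in> M \<Longrightarrow> B \<in> M \<Longrightarrow> A ** B \<in> M"
      using one_closed m_closed by (simp_all add: M2_def)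
  qed (use zero rect \<D> in \<open>simp_all add: definable_mat_iff_defm\<close>)
  show ?thesis by (rule small_Inter_of_definable_submonoid)
qed

end
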